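(* Let $\mathcal A,\mathcal B$ be unital $C^*$-algebras. If there exist a surjective map $\phi:\mathcal A_+^{-1}\to\mathcal B_+^{-1}$ and a positive real number $\gamma\neq1$ such that \[ d_T(\phi(A),\phi(B))=\gamma\, d_T(A,B)\quad\text{for all }A,B\in\mathcal A_+^{-1}, \] then $\mathcal A$ and $\mathcal B$ are commutative.
   Context: $\mathcal A_+^{-1}$ denotes the set of positive invertible elements of $\mathcal A$. The Thompson metric on $\mathcal A_+^{-1}$ is $d_T(A,B)=\log\max\{M(A/B),M(B/A)\}$, where $M(X/Y)=\inf\{t>0: X\le tY\}$; equivalently $d_T(A,B)=\|\log(A^{-1/2}BA^{-1/2})\|$. *)

theory Defs
  imports "HOL-Analysis.Analysis"
begin

class cstar_algebra = real_normed_algebra_1 + banach +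
  fixes scaleC :: "complex \<Rightarrow> 'a \<Rightarrow> 'a"
    and cstar :: "'a \<Rightarrow> 'a"
  assumes scaleC_add_right: "scaleC c (x + y) = scaleC c x + scaleC c y"
    and scaleC_add_left: "scaleC (c + d) x = scaleC c x + scaleC d x"
    and scaleC_scaleC: "scaleC c (scaleC d x) = scaleC (c * d) x"
    and scaleC_one: "scaleC 1 x = x"
    and scaleR_scaleC: "scaleR r x = scaleC (complex_of_real r) x"
    and norm_scaleC: "norm (scaleC c x) = cmod c * norm x"
    and mult_scaleC_left: "scaleC c x * y = scaleC c (x * y)"
    and mult_scaleC_right: "x * scaleC c y = scaleC c (x * y)"
    and cstar_cstar: "cstar (cstar x) = x"
    and cstar_add: "cstar (x + y) = cstar x + cstar y"
    and cstar_scaleC: "cstar (scaleC c x) = scaleC (cnj c) (cstar x)"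
    and cstar_mult: "cstar (x * y) = cstar y * cstar x"
    and cstar_identity: "norm (cstar x * x) = norm x * norm x"

definition invertible_el :: "'a::cstar_algebra \<Rightarrow> bool" where
  "invertible_el x \<longleftrightarrow> (\<exists>y. x * y = 1 \<and> y * x = 1)"

definition spectrum_el :: "'a::cstar_algebra \<Rightarrow> complex set" where
  "spectrum_el x = {c. \<not> invertible_el (x - scaleC c 1)}"

definition self_adjoint :: "'a::cstar_algebra \<Rightarrow> bool" where
  "self_adjoint x \<longleftrightarrow> cstar x = x"

definition positive_el :: "'a::cstar_algebra \<Rightarrow> bool" where
  "positive_el x \<longleftrightarrow> self_adjoint x \<and> spectrum_el x \<subseteq> complex_of_real ` {0..}"

definition cstar_le :: "'a::cstar_algebra \<Rightarrow> 'a \<Rightarrow> bool" where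
  "cstar_le x y \<longleftrightarrow> positive_el (y - x)"

definition pos_inv :: "'a::cstar_algebra set" where
  "pos_inv = {x. positive_el x \<and> invertible_el x}"

definition M_ratio :: "'a::cstar_algebra \<Rightarrow> 'a \<Rightarrow> real" where
  "M_ratio x y = Inf {t::real. t > 0 \<and> cstar_le x (scaleR t y)}"

definition thompson_dist :: "'a::cstar_algebra \<Rightarrow> 'a \<Rightarrow> real" where
  "thompson_dist x y = ln (max (M_ratio x y) (M_ratio y x))"

end

theory Submission
  imports Defs
begin

text \<open>Reflections \<open>x \<mapsto> m x\<inverse> m\<close> are isometries of the Thompson metric \<open>d\<close> which move \<open>x\<close> by exactly
  \<open>2 d m x\<close>, so Vogt's and Vaisala's proof of the Mazur--Ulam theorem shows that a surjective dilation
  \<open>\<phi>\<close> with factor \<open>\<gamma>\<close> satisfies \<open>\<phi> (m x\<inverse> m) = \<phi> m (\<phi> x)\<inverse> \<phi> m\<close>; assuming \<open>\<phi> 1 = 1\<close>, it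
  respects squares and the products \<open>m x m\<close>. Let \<open>x\<^sub>n\<close>, \<open>y\<^sub>n\<close> be the \<open>2^n\<close>-th roots of
  \<open>exp X\<close>, \<open>exp Y\<close>. Then \<open>2^n (\<phi> x\<^sub>n - 1)\<close> and \<open>2^n (\<phi> y\<^sub>n - 1)\<close> converge to some \<open>H\<close>, \<open>K\<close> of norms
  \<open>\<gamma> \<parallel>X\<parallel>\<close>, \<open>\<gamma> \<parallel>Y\<parallel>\<close>, and comparing \<open>x y\<^sup>2 x\<close> with \<open>y x\<^sup>2 y\<close> infinitesimally gives
  \<open>\<parallel>[H,[H,K]]\<parallel> = \<gamma> \<parallel>[X,[X,Y]]\<parallel>\<close>. In every noncommutative \<open>C\<close>*-algebra the trivial bound
  \<open>\<parallel>[X,[X,Y]]\<parallel> \<le> 4 \<parallel>X\<parallel>\<^sup>2 \<parallel>Y\<parallel>\<close> is attained, by elements built from a nonzero nilpotent.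
  So if the domain is noncommutative, then so is the codomain, and \<open>\<gamma>\<^sup>2 \<ge> 1\<close>; the inverse map then
  yields \<open>\<gamma>\<^sup>2 \<le> 1\<close>.\<close>

section \<open>Involution, inverses and spectra\<close>

lemma cstar_zero [simp]: "cstar 0 = 0"
  using cstar_add[of 0 0] by simp

lemma cstar_minus [simp]: "cstar (- x) = - cstar x"
  using cstar_add[of x "- x"] by (simp add: eq_neg_iff_add_eq_0 add.commute)

lemma cstar_diff: "cstar (x - y) = cstar x - cstar y"
  using cstar_add[of x "- y"] by simp

lemma cstar_scaleR: "cstar (scaleR r x) = scaleR r (cstar x)"
  by (simp add: scaleR_scaleC cstar_scaleC)

lemma cstar_one [simp]: "cstar 1 = 1"
  by (metis cstar_cstar cstar_mult mult.left_neutral mult.right_neutral)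

lemma cstar_of_real [simp]: "cstar (of_real r) = of_real r"
  by (simp add: of_real_def cstar_scaleR)

text \<open>The C*-identity and submultiplicativity give one inequality for every element; the other
  is the same inequality at \<open>cstar x\<close>.\<close>

lemma norm_cstar [simp]: "norm (cstar x) = norm x"
proof -
  have le: "norm y \<le> norm (cstar y)" for y :: 'a
  proof (cases "y = 0")
    case False
    have "norm y * norm y \<le> norm (cstar y) * norm y"
      by (metis cstar_identity norm_mult_ineq)
    with False show ?thesis by simp
  qed simp
  show ?thesis using le[of x] le[of "cstar x"] by (simp add: cstar_cstar)
qed

lemma bounded_linear_cstar: "bounded_linear cstar"
  by (rule bounded_linear_intro[where K=1]) (auto simp: cstar_add cstar_scaleR)

lemmas tendsto_cstar = bounded_linear.tendsto[OF bounded_linear_cstar]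

lemma scaleC_zero_left [simp]: "scaleC 0 x = 0"
  using scaleR_scaleC[of 0 x] by simp

lemma scaleC_zero_right [simp]: "scaleC c 0 = 0"
  using scaleC_add_right[of c 0 0] by simp

lemma scaleC_minus_left: "scaleC (- c) x = - scaleC c x"
  using scaleC_add_left[of "- c" c x] by (simp add: eq_neg_iff_add_eq_0)

lemma scaleC_diff_left: "scaleC (c - d) x = scaleC c x - scaleC d x"
  using scaleC_add_left[of c "- d" x] by (simp add: scaleC_minus_left)

lemma scaleC_minus_right: "scaleC c (- x) = - scaleC c x"
  using scaleC_add_right[of c "- x" x] by (simp add: eq_neg_iff_add_eq_0)

lemma scaleC_diff_right: "scaleC c (x - y) = scaleC c x - scaleC c y"
  using scaleC_add_right[of c x "- y"] by (simp add: scaleC_minus_right)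

lemma scaleC_of_real: "scaleC (complex_of_real r) 1 = of_real r"
  by (simp add: of_real_def scaleR_scaleC)

lemma self_adjoint_simps:
  "self_adjoint 0" "self_adjoint 1" "self_adjoint (of_real r)"
  "self_adjoint x \<Longrightarrow> self_adjoint y \<Longrightarrow> self_adjoint (x + y)"
  "self_adjoint x \<Longrightarrow> self_adjoint y \<Longrightarrow> self_adjoint (x - y)"
  "self_adjoint x \<Longrightarrow> self_adjoint (- x)"
  "self_adjoint x \<Longrightarrow> self_adjoint (scaleR r x)"
  "self_adjoint x \<Longrightarrow> self_adjoint (x * x)"
  "self_adjoint x \<Longrightarrow> self_adjoint y \<Longrightarrow> self_adjoint (x * y * x)"
  by (simp_all add: self_adjoint_def cstar_add cstar_diff cstar_scaleR cstar_mult mult.assoc)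

lemma self_adjoint_lim:
  assumes "X \<longlonglongrightarrow> x" "\<And>n. self_adjoint (X n)" shows "self_adjoint x"
  using LIMSEQ_unique[OF tendsto_cstar[OF assms(1)], of x] assms by (simp add: self_adjoint_def)

lemma norm_self_adjoint_square: "self_adjoint x \<Longrightarrow> norm (x * x) = norm x * norm x"
  using cstar_identity[of x] by (simp add: self_adjoint_def)

lemma cstar_power: "cstar (x ^ n) = cstar x ^ n"
  by (induction n) (simp_all add: cstar_mult power_commutes)

text \<open>The C*-identity forbids any loss of norm under repeated squaring. Together with
  \<open>power_norm_less_one\<close> below, this does the work of the spectral radius
  formula.\<close>

lemma norm_self_adjoint_power:
  assumes "self_adjoint x" shows "norm (x ^ (2 ^ k)) = norm x ^ (2 ^ k)"
proof (induction k)
  case (Suc k)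
  have "self_adjoint (x ^ (2 ^ k))"
    using assms by (simp add: self_adjoint_def cstar_power)
  from norm_self_adjoint_square[OF this] Suc show ?case
    by (simp add: power_mult power2_eq_square mult_2 power_add)
qed simp

section \<open>Two-sided inverses and the Neumann series\<close>

definition inv_el :: "'a::cstar_algebra \<Rightarrow> 'a" where
  "inv_el x = (THE y. x * y = 1 \<and> y * x = 1)"

lemma inv_el_eqI:
  assumes "x * y = 1" "y * x = 1" shows "inv_el x = y"
  unfolding inv_el_def
proof (rule the_equality)
  fix z assume "x * z = 1 \<and> z * x = 1"
  then show "z = y" using assms by (metis mult.assoc mult.left_neutral mult.right_neutral)
qed (use assms in simp)

lemma invertible_elI: "x * y = 1 \<Longrightarrow> y * x = 1 \<Longrightarrow> invertible_el x"
  unfolding invertible_el_def by blast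

lemma inv_el_right: "invertible_el x \<Longrightarrow> x * inv_el x = 1"
  and inv_el_left: "invertible_el x \<Longrightarrow> inv_el x * x = 1"
  unfolding invertible_el_def using inv_el_eqI by blast+

lemma inv_el_cancel:
  assumes "invertible_el x"
  shows "x * (inv_el x * y) = y" "inv_el x * (x * y) = y"
  using inv_el_right[OF assms] inv_el_left[OF assms] by (simp_all flip: mult.assoc)

lemmas inv_el_simps = inv_el_right inv_el_left inv_el_cancel

lemma invertible_one [simp]: "invertible_el 1" and inv_el_one [simp]: "inv_el 1 = 1"
  by (auto intro: invertible_elI inv_el_eqI)

lemma invertible_inv_el: "invertible_el x \<Longrightarrow> invertible_el (inv_el x)"
  and inv_el_inv_el: "invertible_el x \<Longrightarrow> inv_el (inv_el x) = x"
  by (auto intro!: invertible_elI[where y=x] inv_el_eqI simp: inv_el_simps)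

lemma inv_el_mult:
  assumes "invertible_el x" "invertible_el y"
  shows "invertible_el (x * y)" "inv_el (x * y) = inv_el y * inv_el x"
  using assms by (auto intro!: invertible_elI[where y="inv_el y * inv_el x"] inv_el_eqI
      simp: inv_el_simps mult.assoc)

text \<open>With \<open>u\<close> the inverse of the product, \<open>y * u\<close> is a right
  inverse and \<open>u * y\<close> a left inverse of \<open>x\<close>, so the two agree.\<close>

lemma invertible_commuting_factor:
  assumes "x * y = y * x" "invertible_el (x * y)" shows "invertible_el x"
proof -
  let ?u = "inv_el (x * y)"
  have "x * (y * ?u) = 1" using inv_el_right[OF assms(2)] by (simp add: mult.assoc)
  moreover have "?u * y * x = 1"
    using inv_el_left[OF assms(2)] by (simp add: mult.assoc assms(1))
  ultimately have "?u * y = y * ?u" by (metis mult.assoc mult.left_neutral mult.right_neutral)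
  with \<open>x * (y * ?u) = 1\<close> \<open>?u * y * x = 1\<close> show ?thesis by (metis invertible_elI)
qed

lemma invertible_scaleC:
  assumes "invertible_el x" "c \<noteq> 0" shows "invertible_el (scaleC c x)"
  by (rule invertible_elI[where y="scaleC (inverse c) (inv_el x)"])
    (use assms in \<open>simp_all add: mult_scaleC_left mult_scaleC_right scaleC_scaleC scaleC_one inv_el_simps\<close>)

lemma invertible_scaleR:
  assumes "invertible_el x" "r \<noteq> 0"
  shows "invertible_el (scaleR r x)" "inv_el (scaleR r x) = scaleR (inverse r) (inv_el x)"
  using assms by (auto intro!: invertible_elI[where y="scaleR (inverse r) (inv_el x)"] inv_el_eqI
      simp: inv_el_simps)

lemma self_adjoint_inv_el:
  assumes "self_adjoint x" "invertible_el x" shows "self_adjoint (inv_el x)"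
proof -
  have "inv_el x = cstar (inv_el x)"
    by (rule inv_el_eqI)
      (metis assms cstar_mult cstar_one inv_el_left inv_el_right self_adjoint_def)+
  then show ?thesis by (simp add: self_adjoint_def)
qed

lemma neumann:
  fixes x :: "'a::cstar_algebra"
  assumes "norm x < 1"
  shows "invertible_el (1 - x)" "norm (inv_el (1 - x)) \<le> 1 / (1 - norm x)"
proof -
  have s: "summable (\<lambda>i. x ^ i)"
    using assms by (rule complete_algebra_summable_geometric)
  let ?y = "\<Sum>i. x ^ i"
  have eq: "?y = 1 + (\<Sum>i. x ^ Suc i)"
    using suminf_split_head[OF s] by simp
  have "(\<Sum>i. x ^ Suc i) = x * ?y" "(\<Sum>i. x ^ Suc i) = ?y * x"
    using suminf_mult[OF s, of x] suminf_mult2[OF s, of x] by (simp_all add: power_commutes)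
  with eq have 1: "(1 - x) * ?y = 1" "?y * (1 - x) = 1"
    by (simp_all add: algebra_simps)
  then show inv: "invertible_el (1 - x)" by (rule invertible_elI)
  let ?z = "inv_el (1 - x)"
  \<comment> \<open>Taking norms in this fixed-point equation yields the bound without estimating
    the series.\<close>
  have "?z = 1 + x * ?z" using inv_el_right[OF inv] by (simp add: algebra_simps)
  then have "norm ?z \<le> 1 + norm x * norm ?z"
    by (metis add_left_mono norm_mult_ineq norm_one norm_triangle_le)
  then show "norm ?z \<le> 1 / (1 - norm x)"
    using assms by (simp add: field_simps)
qed

text \<open>Factoring \<open>y = x * (1 - u)\<close> with \<open>norm u <= 1 / 2\<close> reduces to
  the Neumann series. The Lipschitz bound follows from
  \<open>inv_el y - inv_el x = inv_el y * (x - y) * inv_el x\<close>.\<close>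

lemma invertible_near:
  assumes x: "invertible_el x" and d: "norm (y - x) * norm (inv_el x) \<le> 1 / 2"
  shows "invertible_el y"
    "norm (inv_el y - inv_el x) \<le> 2 * norm (inv_el x) ^ 2 * norm (y - x)"
proof -
  let ?u = "inv_el x * (x - y)"
  have u: "norm ?u \<le> 1 / 2"
    using d norm_mult_ineq[of "inv_el x" "x - y"] by (simp add: norm_minus_commute mult.commute)
  then have n: "invertible_el (1 - ?u)" "norm (inv_el (1 - ?u)) \<le> 1 / (1 - norm ?u)"
    using neumann[of ?u] by simp_all
  have "1 / (1 - norm ?u) \<le> 2" using u by (simp add: field_simps)
  with n have n2: "norm (inv_el (1 - ?u)) \<le> 2" by linarith
  have y: "y = x * (1 - ?u)" by (simp add: algebra_simps inv_el_simps[OF x])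
  show iy: "invertible_el y" using inv_el_mult(1)[OF x n(1)] y by simp
  have "inv_el y = inv_el (1 - ?u) * inv_el x" using inv_el_mult(2)[OF x n(1)] y by simp
  then have "norm (inv_el y) \<le> norm (inv_el (1 - ?u)) * norm (inv_el x)"
    by (metis norm_mult_ineq)
  also have "\<dots> \<le> 2 * norm (inv_el x)" using n2 by (intro mult_right_mono) auto
  finally have "norm (inv_el y) \<le> 2 * norm (inv_el x)" .
  moreover have "inv_el y - inv_el x = inv_el y * (x - y) * inv_el x"
    by (simp add: algebra_simps inv_el_simps x iy)
  then have "norm (inv_el y - inv_el x) \<le> norm (inv_el y * (x - y)) * norm (inv_el x)"
    by (simp add: norm_mult_ineq)
  then have "norm (inv_el y - inv_el x) \<le> norm (inv_el y) * norm (y - x) * norm (inv_el x)"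
    using mult_right_mono[OF norm_mult_ineq[of "inv_el y" "x - y"] norm_ge_zero[of "inv_el x"]]
    by (simp add: norm_minus_commute)
  moreover have "norm (inv_el y) * norm (y - x) * norm (inv_el x)
      \<le> 2 * norm (inv_el x) * norm (y - x) * norm (inv_el x)"
    using calculation(1) by (intro mult_right_mono) auto
  ultimately show "norm (inv_el y - inv_el x) \<le> 2 * norm (inv_el x) ^ 2 * norm (y - x)"
    by (simp add: power2_eq_square algebra_simps)
qed

lemma isCont_inv_el:
  assumes x: "invertible_el x" shows "isCont inv_el x"
  unfolding isCont_def
proof (rule Lim_null[THEN iffD2], rule Lim_null_comparison)
  let ?K = "norm (inv_el x)"
  have K: "?K > 0" using inv_el_right[OF x] by auto
  have "\<forall>\<^sub>F y in at x. dist y x < 1 / (2 * ?K)"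
    unfolding eventually_at using K by (intro exI[of _ "1 / (2 * ?K)"]) auto
  then show "\<forall>\<^sub>F y in at x. norm (inv_el y - inv_el x) \<le> 2 * ?K ^ 2 * norm (y - x)"
    by eventually_elim (rule invertible_near(2)[OF x], use K in \<open>simp add: dist_norm field_simps\<close>)
  show "((\<lambda>y. 2 * ?K ^ 2 * norm (y - x)) \<longlongrightarrow> 0) (at x)"
    by (auto intro!: tendsto_eq_intros)
qed

lemma tendsto_inv_el: "invertible_el x \<Longrightarrow> (f \<longlongrightarrow> x) F \<Longrightarrow> ((\<lambda>t. inv_el (f t)) \<longlongrightarrow> inv_el x) F"
  using isCont_inv_el isCont_tendsto_compose by blast

section \<open>Spectra and norms\<close>

lemma spectrum_norm_le:
  assumes "c \<in> spectrum_el x" shows "cmod c \<le> norm x"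
proof (rule ccontr)
  assume "\<not> cmod c \<le> norm x"
  then have c: "cmod c > norm x" by simp
  then have c0: "c \<noteq> 0" by auto
  have "norm (scaleC (inverse c) x) < 1"
    using c c0 by (simp add: norm_scaleC norm_inverse norm_divide field_simps)
  then have "invertible_el (scaleC (- c) (1 - scaleC (inverse c) x))"
    using c0 by (intro invertible_scaleC neumann) auto
  also have "scaleC (- c) (1 - scaleC (inverse c) x) = x - scaleC c 1"
    using c0 by (simp add: scaleC_diff_right scaleC_minus_left scaleC_scaleC scaleC_one)
  finally show False using assms by (simp add: spectrum_el_def)
qed

text \<open>Arens' trick: for real \<open>t\<close> one has \<open>norm (h + it)^2 \<le> norm h^2 + t^2\<close>, while a spectral
  value \<open>ib\<close> of \<open>h\<close> would give \<open>(b + t)^2 \<le> norm (h + it)^2\<close>.\<close>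

lemma self_adjoint_spectrum_real:
  assumes h: "self_adjoint h" and c: "c \<in> spectrum_el h" shows "Im c = 0"
proof (rule ccontr)
  assume b: "Im c \<noteq> 0"
  define k where "k = h - of_real (Re c)"
  \<comment> \<open>This choice makes \<open>2 * Im c * t\<close> equal to
    \<open>(norm k)^2\<close>, so that the final comparison leaves
    \<open>(Im c)^2 <= 0\<close>.\<close>
  define t where "t = (norm k)\<^sup>2 / (2 * Im c)"
  have k: "self_adjoint k" using h by (simp add: k_def self_adjoint_simps)
  let ?u = "k + scaleC (\<i> * of_real t) 1"
  have "h - scaleC c 1 = ?u - scaleC (\<i> * of_real (Im c + t)) 1"
    by (subst (1) complex_eq[of c])
      (simp add: k_def algebra_simps scaleC_add_left scaleC_of_real[symmetric])
  then have "\<i> * of_real (Im c + t) \<in> spectrum_el ?u" using c by (simp add: spectrum_el_def)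
  then have "\<bar>Im c + t\<bar> \<le> norm ?u"
    using spectrum_norm_le by (fastforce simp: norm_mult simp del: of_real_add)
  then have "(Im c + t)\<^sup>2 \<le> norm ?u * norm ?u"
    by (metis abs_le_square_iff abs_norm_cancel power2_eq_square)
  also have "\<dots> = norm (cstar ?u * ?u)" by (simp add: cstar_identity)
  also have "cstar ?u * ?u = k * k + of_real (t * t)"
    using k by (simp add: self_adjoint_def cstar_add cstar_scaleC algebra_simps scaleC_minus_left
      mult_scaleC_left mult_scaleC_right scaleC_scaleC scaleC_of_real[symmetric] scaleC_diff_right)
  also have "norm \<dots> \<le> norm (k * k) + norm (of_real (t * t) :: 'a)"
    by (rule norm_triangle_ineq)
  also have "\<dots> = (norm k)\<^sup>2 + t\<^sup>2"
    by (simp add: norm_self_adjoint_square[OF k] power2_eq_square abs_mult del: of_real_mult)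
  finally have "(Im c)\<^sup>2 + 2 * Im c * t \<le> (norm k)\<^sup>2" by (simp add: power2_sum)
  moreover have "2 * Im c * t = (norm k)\<^sup>2" using b by (simp add: t_def)
  ultimately show False using b by simp
qed

text \<open>An elementary substitute for the spectral radius formula. The resolvents
  \<open>R_b(z) = (1 - z b)^{-1}\<close> satisfy \<open>R_{b^2}(w^2) = (R_b(w) + R_b(-w)) / 2\<close>, so that a modulus of
  continuity of \<open>R_a\<close> on the closed unit disc is inherited by all \<open>R_{a^{2^k}}\<close>.\<close>

lemma power_norm_less_one:
  fixes a :: "'a::cstar_algebra"
  assumes a: "norm a \<le> 1" and inv: "\<And>z. cmod z \<le> 1 \<Longrightarrow> invertible_el (1 - scaleC z a)"
  shows "\<exists>k. norm (a ^ (2 ^ k)) < 1"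
proof -
  define b where "b k = a ^ (2 ^ k)" for k :: nat
  define R where "R k z = inv_el (1 - scaleC z (b k))" for k z
  have b_Suc: "b (Suc k) = b k * b k" for k by (simp add: b_def mult_2 power_add)
  have b_le: "norm (b k) \<le> 1" for k
    unfolding b_def by (meson a norm_ge_zero norm_power_ineq order.trans power_le_one)
  have bl: "bounded_linear (\<lambda>z. scaleC z a)"
    by (rule bounded_linear_intro[where K="norm a"])
      (auto simp: scaleC_add_left norm_scaleC scaleR_scaleC scaleC_scaleC scaleR_conv_of_real)
  have "continuous_on (cball 0 1) (R 0)"
    unfolding R_def b_def continuous_on_def
    by (auto intro!: tendsto_inv_el inv tendsto_intros bounded_linear.tendsto[OF bl])
  then have "uniformly_continuous_on (cball 0 1) (R 0)"
    by (intro compact_uniformly_continuous) auto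
  then obtain d where d: "d > 0" "\<And>z w. cmod z \<le> 1 \<Longrightarrow> cmod w \<le> 1 \<Longrightarrow> dist z w < d
      \<Longrightarrow> dist (R 0 z) (R 0 w) < 1 / 8"
    unfolding uniformly_continuous_on_def by (metis mem_cball_0 zero_less_divide_1_iff zero_less_numeral dist_commute)
  \<comment> \<open>A radius below 1, but so close to it that \<open>R 0\<close> changes by at most
    \<open>1 / 8\<close> between \<open>z\<close> and \<open>t * z\<close> for all \<open>z\<close>
    in the closed disc.\<close>
  define t where "t = max (1 / 2) (1 - d / 2)"
  have t: "0 < t" "t < 1" "1 - t < d" using d(1) by (auto simp: t_def)
  \<comment> \<open>The factors \<open>p = 1 - w b\<close> and \<open>q = 1 + w b\<close> commute
    and satisfy \<open>p + q = 2\<close> and \<open>p * q = 1 - w^2 b^2\<close>, whence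
    \<open>p^-1 + q^-1 = 2 (p q)^-1\<close>.\<close>
  have sq: "invertible_el (1 - scaleC (w * w) (b (Suc k))) \<and>
      R (Suc k) (w * w) = scaleR (1 / 2) (R k w + R k (- w))"
    if i: "invertible_el (1 - scaleC w (b k))" "invertible_el (1 - scaleC (- w) (b k))" for w k
  proof -
    let ?p = "1 - scaleC w (b k)" and ?q = "1 - scaleC (- w) (b k)"
    have e: "1 - scaleC (w * w) (b (Suc k)) = ?p * ?q" and c: "?p * ?q = ?q * ?p"
      by (simp_all add: b_Suc algebra_simps scaleC_minus_left scaleC_diff_right scaleC_add_right mult_scaleC_left mult_scaleC_right scaleC_scaleC)
    have s: "?p + ?q = scaleR 2 1" by (simp add: scaleC_minus_left scaleR_2)
    have l: "?p * ?q * (inv_el ?p + inv_el ?q) = scaleR 2 1"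
      unfolding distrib_left by (subst (1) c) (simp add: mult.assoc inv_el_simps i s[symmetric])
    have r: "(inv_el ?p + inv_el ?q) * (?p * ?q) = scaleR 2 1"
      unfolding distrib_right by (subst (2) c) (simp add: inv_el_simps i s[symmetric])
    show ?thesis unfolding R_def e
      using l r by (auto intro!: inv_el_eqI invertible_elI[where y="scaleR (1 / 2) (inv_el ?p + inv_el ?q)"])
  qed
  \<comment> \<open>Averaging over the two square roots of \<open>z\<close> keeps the error
    \<open>1 / 8\<close>, while the comparison radius is squared at each stage.\<close>
  have main: "\<forall>z. cmod z \<le> 1 \<longrightarrow> invertible_el (1 - scaleC z (b k)) \<and>
      norm (R k z - R k (of_real (t ^ (2 ^ k)) * z)) \<le> 1 / 8" for k
  proof (induction k)
    case 0
    have "norm (R 0 z - R 0 (of_real t * z)) \<le> 1 / 8" if z: "cmod z \<le> 1" for z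
    proof -
      have "cmod (of_real t * z) \<le> 1" using t z by (simp add: norm_mult mult_le_one)
      moreover have "dist z (of_real t * z) = (1 - t) * cmod z"
        using t by (metis (no_types, lifting) abs_of_pos diff_gt_0_iff_gt dist_norm left_diff_distrib
            mult.left_neutral norm_mult norm_of_real of_real_1 of_real_diff)
      moreover have "(1 - t) * cmod z < d" using t z by (smt (verit) mult_left_le)
      ultimately show ?thesis using d(2)[OF z] by (simp add: dist_norm less_imp_le)
    qed
    then show ?case using inv by (simp add: b_def)
  next
    case (Suc k)
    show ?case
    proof (intro allI impI)
      fix z assume z: "cmod z \<le> 1"
      define w where "w = csqrt z"
      define s where "s = complex_of_real (t ^ (2 ^ k))"
      have w: "w * w = z" by (metis w_def power2_csqrt power2_eq_square)
      have w1: "cmod w \<le> 1" using z by (simp add: w_def norm_csqrt)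
      have "cmod s \<le> 1" unfolding s_def using t by (simp add: norm_power power_le_one)
      then have sw: "cmod (s * w) \<le> 1" using w1 by (simp add: norm_mult mult_le_one)
      have e: "complex_of_real (t ^ (2 ^ Suc k)) * z = (s * w) * (s * w)"
        by (simp add: s_def w[symmetric] mult_2 power_add mult_ac)
      have 1: "R (Suc k) z = scaleR (1 / 2) (R k w + R k (- w))" "invertible_el (1 - scaleC z (b (Suc k)))"
        using sq[of w k] Suc w1 w by auto
      have 2: "R (Suc k) (complex_of_real (t ^ (2 ^ Suc k)) * z) = scaleR (1 / 2) (R k (s * w) + R k (- (s * w)))"
        unfolding e using sq[of "s * w" k] Suc sw by auto
      have "R (Suc k) z - R (Suc k) (complex_of_real (t ^ (2 ^ Suc k)) * z)
        = scaleR (1 / 2) ((R k w - R k (s * w)) + (R k (- w) - R k (s * - w)))"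
        unfolding 1 2 by (simp add: algebra_simps)
      also have "norm \<dots> \<le> 1 / 2 * (1 / 8 + 1 / 8)"
        unfolding norm_scaleR
        using Suc[rule_format, of w] Suc[rule_format, of "- w"] w1 unfolding s_def[symmetric]
        by (intro mult_mono norm_triangle_mono) auto
      finally show "invertible_el (1 - scaleC z (b (Suc k))) \<and>
         norm (R (Suc k) z - R (Suc k) (of_real (t ^ (2 ^ Suc k)) * z)) \<le> 1 / 8"
        using 1(2) by simp
    qed
  qed
  \<comment> \<open>The radius is now driven to 0, where the resolvent is close to 1. Hence
    \<open>R N 1\<close> is within \<open>1 / 4\<close> of 1, and
    \<open>b N = (1 - b N) * (R N 1 - 1)\<close> has norm at most \<open>1 / 2\<close>.\<close>
  have "(\<lambda>n. t ^ n) \<longlonglongrightarrow> 0" using t by (intro LIMSEQ_power_zero) auto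
  then obtain N where N: "t ^ n < 1 / 9" if "n \<ge> N" for n
    using t by (metis abs_of_nonneg less_eq_real_def order_tendstoD(2) eventually_sequentially
       zero_less_divide_1_iff zero_less_numeral)
  define s where "s = t ^ (2 ^ N)"
  have s: "0 \<le> s" "s < 1 / 9" using N[of "2 ^ N"] t by (auto simp: s_def less_imp_le self_le_power)
  let ?r = "R N 1" and ?c = "scaleC (of_real s) (b N)"
  have c: "norm ?c \<le> 1 / 9" using b_le[of N] s by (simp add: norm_scaleC) (smt (verit) mult_left_le)
  have "invertible_el (1 - ?c)" using neumann(1)[of ?c] c by simp
  from inv_el_left[OF this] have "R N (of_real s) - 1 = R N (of_real s) * ?c"
    unfolding R_def by (simp add: algebra_simps)
  moreover have "norm (R N (of_real s)) \<le> 9 / 8"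
  proof -
    have "norm (R N (of_real s)) \<le> 1 / (1 - norm ?c)" unfolding R_def using neumann(2)[of ?c] c by simp
    also have "\<dots> \<le> 9 / 8" using c by (simp add: field_simps)
    finally show ?thesis .
  qed
  ultimately have "norm (R N (of_real s) - 1) \<le> 9 / 8 * (1 / 9)"
    using c norm_mult_ineq[of "R N (of_real s)" ?c] mult_mono[of "norm (R N (of_real s))" "9 / 8" "norm ?c" "1 / 9"]
    by simp
  moreover have "norm (?r - R N (of_real s)) \<le> 1 / 8" and i: "invertible_el (1 - b N)"
    using main[of N] by (auto simp: s_def scaleC_one dest!: spec[of _ 1])
  ultimately have e: "norm (?r - 1) \<le> 1 / 4"
    using norm_triangle_ineq[of "?r - R N (of_real s)" "R N (of_real s) - 1"] by simp
  have "b N = (1 - b N) * (?r - 1)"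
    using inv_el_right[OF i] by (simp add: R_def scaleC_one algebra_simps)
  then have "norm (b N) \<le> norm (1 - b N) * norm (?r - 1)" by (metis norm_mult_ineq)
  also have "\<dots> \<le> 2 * (1 / 4)"
    using e b_le[of N] norm_triangle_ineq4[of 1 "b N"] by (intro mult_mono) auto
  finally show ?thesis unfolding b_def by (intro exI[of _ N]) simp
qed

text \<open>If \<open>norm h > t\<close>, normalize \<open>h\<close> to norm 1. All
  \<open>1 - z a\<close> with \<open>z\<close> in the closed disc are then invertible, so some power
  \<open>2 ^ k\<close> has norm below 1, contradicting
  \<open>norm_self_adjoint_power\<close>.\<close>

lemma norm_le_spectral_bound:
  assumes h: "self_adjoint h" and t: "t \<ge> 0" and s: "\<And>c. c \<in> spectrum_el h \<Longrightarrow> cmod c \<le> t"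
  shows "norm h \<le> t"
proof (rule ccontr)
  assume "\<not> norm h \<le> t"
  then have n: "norm h > t" by simp
  then have n0: "norm h > 0" using t by linarith
  let ?a = "scaleR (1 / norm h) h"
  have na: "norm ?a = 1" using n0 by simp
  have "\<exists>k. norm (?a ^ (2 ^ k)) < 1"
  proof (rule power_norm_less_one)
    fix z assume z: "cmod z \<le> 1"
    show "invertible_el (1 - scaleC z ?a)"
    proof (cases "z = 0")
      case False
      let ?c = "of_real (norm h) / z"
      have "cmod ?c > t"
      proof -
        have "norm h \<le> norm h / cmod z" using z n0 False by (simp add: field_simps mult_left_le)
        then show ?thesis using n by (simp add: norm_divide)
      qed
      then have "invertible_el (h - scaleC ?c 1)" using s[of ?c] by (force simp: spectrum_el_def)
      then have "invertible_el (scaleC (- inverse ?c) (h - scaleC ?c 1))"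
        using False n0 by (intro invertible_scaleC) auto
      also have "scaleC (- inverse ?c) (h - scaleC ?c 1) = 1 - scaleC z ?a"
        using False n0 by (simp add: scaleC_diff_right scaleC_minus_left scaleC_scaleC scaleC_one scaleR_scaleC)
      finally show ?thesis .
    qed simp
  qed (use na in simp)
  then show False
    using norm_self_adjoint_power[of ?a] h na by (auto simp: self_adjoint_simps)
qed

section \<open>Positive elements\<close>

lemma spectrum_add_of_real: "c \<in> spectrum_el (h + of_real r) \<longleftrightarrow> c - of_real r \<in> spectrum_el h"
  by (simp add: spectrum_el_def scaleC_diff_left scaleC_of_real algebra_simps)

lemma spectrum_uminus: "c \<in> spectrum_el (- h) \<longleftrightarrow> - c \<in> spectrum_el h"
proof -
  have "invertible_el (- x)" if "invertible_el x" for x :: 'a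
    using invertible_scaleC[OF that, of "- 1"] by (simp add: scaleC_minus_left scaleC_one)
  from this[of "- h - scaleC c 1"] this[of "h - scaleC (- c) 1"] show ?thesis
    by (auto simp: spectrum_el_def scaleC_minus_left algebra_simps)
qed

lemma spectrum_of_real_diff: "c \<in> spectrum_el (of_real r - h) \<longleftrightarrow> of_real r - c \<in> spectrum_el h"
  using spectrum_add_of_real[of c "- h" r] spectrum_uminus[of "c - of_real r" h] by simp

lemma positive_self_adjoint: "positive_el h \<Longrightarrow> self_adjoint h"
  by (simp add: positive_el_def)

lemma positive_el_iff:
  "positive_el h \<longleftrightarrow> self_adjoint h \<and> (\<forall>c \<in> spectrum_el h. Re c \<ge> 0)"
proof -
  have "c \<in> complex_of_real ` {0..} \<longleftrightarrow> Im c = 0 \<and> Re c \<ge> 0" for c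
    by (auto simp: complex_eq_iff intro: image_eqI[of _ _ "Re c"])
  then show ?thesis
    unfolding positive_el_def using self_adjoint_spectrum_real by blast
qed

text \<open>With its converse \<open>norm_if_positive_el\<close>, this turns positivity into a norm
  inequality, so that closure of the cone under sums and limits follows from the triangle inequality
  and continuity.\<close>

lemma positive_el_if_norm:
  assumes "self_adjoint h" "norm (of_real r - h) \<le> r" shows "positive_el h"
  unfolding positive_el_iff
proof (intro conjI ballI)
  fix c assume "c \<in> spectrum_el h"
  then have "of_real r - c \<in> spectrum_el (of_real r - h)" by (simp add: spectrum_of_real_diff)
  then have "cmod (of_real r - c) \<le> r" using spectrum_norm_le assms(2) by fastforce
  then show "Re c \<ge> 0" using complex_Re_le_cmod[of "of_real r - c"] by simp
qed fact

lemma norm_if_positive_el: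
  assumes "positive_el h" "norm h \<le> r" shows "norm (of_real r - h) \<le> r"
proof (rule norm_le_spectral_bound)
  have h: "self_adjoint h" using assms(1) by (rule positive_self_adjoint)
  then show "self_adjoint (of_real r - h)" by (simp add: self_adjoint_simps)
  show "0 \<le> r" using assms(2) norm_ge_zero order.trans by blast
  fix c assume "c \<in> spectrum_el (of_real r - h)"
  then have s: "of_real r - c \<in> spectrum_el h" by (simp add: spectrum_of_real_diff)
  then have "Im c = 0" "Re c \<le> r" "cmod (of_real r - c) \<le> r"
    using self_adjoint_spectrum_real[OF h s] assms spectrum_norm_le[OF s] by (auto simp: positive_el_iff)
  then show "cmod c \<le> r" by (simp add: cmod_eq_Re)
qed

lemma positive_add: "positive_el (x + y)" if "positive_el x" "positive_el y"
proof (rule positive_el_if_norm[where r="norm x + norm y"])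
  have "norm ((of_real (norm x) - x) + (of_real (norm y) - y)) \<le> norm x + norm y"
    using norm_if_positive_el[OF that(1) order_refl] norm_if_positive_el[OF that(2) order_refl]
    by (intro norm_triangle_mono)
  then show "norm (of_real (norm x + norm y) - (x + y)) \<le> norm x + norm y"
    by (simp add: algebra_simps)
qed (use that in \<open>simp add: positive_self_adjoint self_adjoint_simps\<close>)

lemma positive_lim:
  assumes l: "X \<longlonglongrightarrow> x" and p: "\<And>n. positive_el (X n)" shows "positive_el x"
proof (rule positive_el_if_norm[where r="norm x"])
  show "self_adjoint x" using l positive_self_adjoint[OF p] by (rule self_adjoint_lim)
  show "norm (of_real (norm x) - x) \<le> norm x"
    by (rule LIMSEQ_le[where X="\<lambda>n. norm (of_real (norm (X n)) - X n)" and Y="\<lambda>n. norm (X n)"])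
      (auto intro!: tendsto_intros l norm_if_positive_el p)
qed

lemma positive_of_real: "r \<ge> 0 \<Longrightarrow> positive_el (of_real r)"
  by (rule positive_el_if_norm[where r=r]) (simp_all add: self_adjoint_simps)

lemma positive_zero: "positive_el 0"
  using positive_of_real[of 0] by simp

lemma positive_one: "positive_el 1"
  using positive_of_real[of 1] by simp

lemma positive_scaleR:
  assumes "positive_el x" "r \<ge> 0" shows "positive_el (scaleR r x)"
proof (rule positive_el_if_norm[where r="r * norm x"])
  have "of_real (r * norm x) - scaleR r x = scaleR r (of_real (norm x) - x)"
    by (simp add: scaleR_diff_right of_real_def)
  then show "norm (of_real (r * norm x) - scaleR r x) \<le> r * norm x"
    using norm_if_positive_el[OF assms(1) order_refl] assms(2) by (simp add: mult_left_mono)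
qed (use assms in \<open>simp add: positive_self_adjoint self_adjoint_simps\<close>)

text \<open>The spectrum being real, only negative real spectral values have to be excluded. This
  algebraic test suits products better than the norm criterion.\<close>

lemma positive_iff_shifts_invertible:
  assumes "self_adjoint h"
  shows "positive_el h \<longleftrightarrow> (\<forall>l>0. invertible_el (h + of_real l))"
proof
  assume p: "positive_el h"
  show "\<forall>l>0. invertible_el (h + of_real l)"
  proof (intro allI impI)
    fix l :: real assume "l > 0"
    then have "of_real (- l) \<notin> spectrum_el h" using p by (auto simp: positive_el_iff)
    then show "invertible_el (h + of_real l)"
      by (simp add: spectrum_el_def scaleC_minus_left scaleC_of_real)
  qed
next
  assume inv: "\<forall>l>0. invertible_el (h + of_real l)"
  show "positive_el h" unfolding positive_el_iff
  proof (intro conjI ballI)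
    fix c assume c: "c \<in> spectrum_el h"
    then have "c = of_real (Re c)"
      using self_adjoint_spectrum_real[OF assms c] by (simp add: complex_eq_iff)
    then have "\<not> invertible_el (h - of_real (Re c))"
      using c by (metis mem_Collect_eq scaleC_of_real spectrum_el_def)
    then show "Re c \<ge> 0" using inv[rule_format, of "- Re c"] by (force simp: not_le)
  qed fact
qed

text \<open>For \<open>l > 0\<close> the shift \<open>h * h + l\<close> factors into
  \<open>h - i sqrt l\<close> and \<open>h + i sqrt l\<close>, both invertible because the spectrum
  of \<open>h\<close> is real.\<close>

lemma positive_square:
  assumes "self_adjoint h" shows "positive_el (h * h)"
  unfolding positive_iff_shifts_invertible[OF self_adjoint_simps(8)[OF assms]]
proof (intro allI impI)
  fix l :: real assume l: "l > 0"
  let ?c = "\<i> * of_real (sqrt l)"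
  have "invertible_el (h - scaleC c 1)" if "Im c \<noteq> 0" for c
    using that self_adjoint_spectrum_real[OF assms, of c] by (auto simp: spectrum_el_def)
  then have "invertible_el ((h - scaleC ?c 1) * (h - scaleC (- ?c) 1))"
    using l by (intro inv_el_mult) simp_all
  also have "(h - scaleC ?c 1) * (h - scaleC (- ?c) 1) = h * h - scaleC (?c * ?c) 1"
    by (simp add: algebra_simps scaleC_minus_left mult_scaleC_left mult_scaleC_right scaleC_scaleC
        scaleC_add_right scaleC_diff_right)
  also have "?c * ?c = of_real (- l)" using l by (simp add: complex_eq_iff)
  finally show "invertible_el (h * h + of_real l)" by (simp only: scaleC_of_real) simp
qed

lemma norm_le_iff_positive:
  assumes "self_adjoint h" "t \<ge> 0"
  shows "norm h \<le> t \<longleftrightarrow> positive_el (of_real t - h) \<and> positive_el (of_real t + h)"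
proof
  assume "norm h \<le> t"
  then show "positive_el (of_real t - h) \<and> positive_el (of_real t + h)"
    using assms by (auto intro!: positive_el_if_norm[where r=t] simp: self_adjoint_simps)
next
  assume p: "positive_el (of_real t - h) \<and> positive_el (of_real t + h)"
  show "norm h \<le> t"
  proof (rule norm_le_spectral_bound)
    fix c assume c: "c \<in> spectrum_el h"
    have "of_real t - c \<in> spectrum_el (of_real t - h)" using c by (simp add: spectrum_of_real_diff)
    moreover have "of_real t + c \<in> spectrum_el (of_real t + h)"
      using c spectrum_add_of_real[of "of_real t + c" h t] by (simp add: add.commute)
    ultimately have "Re c \<le> t" "- t \<le> Re c" using p by (force simp: positive_el_iff)+
    with self_adjoint_spectrum_real[OF assms(1) c] show "cmod c \<le> t"
      by (simp add: cmod_eq_Re abs_le_iff)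
  qed (use assms in auto)
qed

lemma positive_norm_le_iff:
  assumes "positive_el h" "t \<ge> 0"
  shows "norm h \<le> t \<longleftrightarrow> positive_el (of_real t - h)"
  using norm_le_iff_positive[OF positive_self_adjoint[OF assms(1)] assms(2)]
    positive_add[OF positive_of_real[OF assms(2)] assms(1)] by blast

lemma positive_antisym: "positive_el h \<Longrightarrow> positive_el (- h) \<Longrightarrow> h = 0"
  using norm_le_iff_positive[of h 0] by (simp add: positive_self_adjoint)

text \<open>The iteration \<open>y \<mapsto> (x + y^2) / 2\<close> solves \<open>(1 - y)^2 = 1 - x\<close>; it is dominated by the same
  iteration for the scalar \<open>1\<close>, which increases to a limit.\<close>

lemma sqrt_one_minus:
  fixes x :: "'a::cstar_algebra"
  assumes x: "self_adjoint x" "norm x \<le> 1"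
  obtains y where "self_adjoint y" "norm y \<le> 1" "(1 - y) * (1 - y) = 1 - x"
    "\<And>z. x * z = z * x \<Longrightarrow> y * z = z * y"
proof -
  define Y where "Y = rec_nat 0 (\<lambda>_ y. scaleR (1 / 2) (x + y * y))"
  define T where "T = rec_nat 0 (\<lambda>_ t. (1 + t * t) / (2::real))"
  have Y: "Y 0 = 0" "Y (Suc n) = scaleR (1 / 2) (x + Y n * Y n)" for n by (simp_all add: Y_def)
  have T: "T 0 = 0" "T (Suc n) = (1 + T n * T n) / 2" for n by (simp_all add: T_def)
  have T01: "0 \<le> T n \<and> T n \<le> 1" for n
    by (induction n) (auto simp: T intro: mult_le_one)
  have YT: "norm (Y n) \<le> T n" for n
  proof (induction n)
    case (Suc n)
    have "norm (x + Y n * Y n) \<le> 1 + T n * T n"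
      using x Suc T01[of n] by (intro norm_triangle_mono order.trans[OF norm_mult_ineq] mult_mono) auto
    then show ?case by (simp add: Y T)
  qed (simp add: Y T)
  have comm: "Y n * z = z * Y n" if "x * z = z * x" for z n
  proof (induction n)
    case (Suc n)
    then have "Y n * Y n * z = z * (Y n * Y n)" by (metis mult.assoc)
    then show ?case using that by (simp add: Y distrib_left distrib_right)
  qed (simp add: Y)
  have Yx: "x * Y n = Y n * x" for n using comm[of x n] by simp
  have cYY: "Y m * Y n = Y n * Y m" for m n by (rule comm) (rule Yx)
  have step: "norm (Y (Suc n) - Y n) \<le> T (Suc n) - T n" for n
  proof (induction n)
    case (Suc n)
    let ?d = "Y (Suc n) - Y n" and ?s = "Y (Suc n) + Y n"
    \<comment> \<open>Since the iterates commute, the difference of squares factors into a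
      difference and a sum, and each factor is dominated by its scalar counterpart.\<close>
    have "Y (Suc (Suc n)) - Y (Suc n) = scaleR (1 / 2) (Y (Suc n) * Y (Suc n) - Y n * Y n)"
      unfolding Y(2)[of "Suc n"] by (subst (3) Y(2)) (simp add: scaleR_diff_right[symmetric])
    also have "Y (Suc n) * Y (Suc n) - Y n * Y n = ?d * ?s"
      using cYY[of n "Suc n"] by (simp add: algebra_simps)
    finally have "norm (Y (Suc (Suc n)) - Y (Suc n)) \<le> 1 / 2 * (norm ?d * norm ?s)"
      using norm_mult_ineq[of ?d ?s] by simp
    also have "\<dots> \<le> 1 / 2 * ((T (Suc n) - T n) * (T (Suc n) + T n))"
      using Suc YT order.trans[OF norm_ge_zero Suc]
      by (intro mult_left_mono mult_mono norm_triangle_mono) auto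
    also have "\<dots> = T (Suc (Suc n)) - T (Suc n)"
      using T(2)[of n] T(2)[of "Suc n"] by (simp add: field_simps)
    finally show ?case .
  qed (use x in \<open>simp add: Y T\<close>)
  have Tmono: "incseq T"
    using step by (intro incseq_SucI) (smt (verit) norm_ge_zero)
  moreover have "\<forall>i. T i \<le> 1" using T01 by blast
  ultimately obtain L where L: "T \<longlonglongrightarrow> L" by (rule incseq_convergent)
  have le': "norm (Y (n + k) - Y n) \<le> T (n + k) - T n" for n k
  proof (induction k)
    case (Suc k)
    then show ?case
      using norm_triangle_ineq[of "Y (Suc (n + k)) - Y (n + k)" "Y (n + k) - Y n"] step[of "n + k"] by simp
  qed simp
  then have le: "norm (Y m - Y n) \<le> \<bar>T m - T n\<bar>" for m n
    using le'[of n "m - n"] le'[of m "n - m"] by (cases "n \<le> m") (auto simp: norm_minus_commute)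
  have "Cauchy Y"
  proof (rule CauchyI)
    fix e :: real assume "e > 0"
    then obtain M where "\<And>m n. m \<ge> M \<Longrightarrow> n \<ge> M \<Longrightarrow> norm (T m - T n) < e"
      using CauchyD[OF LIMSEQ_imp_Cauchy[OF L]] by blast
    then have "norm (Y m - Y n) < e" if "m \<ge> M" "n \<ge> M" for m n
      using that le[of m n] by fastforce
    then show "\<exists>M. \<forall>m\<ge>M. \<forall>n\<ge>M. norm (Y m - Y n) < e" by blast
  qed
  then obtain y where y: "Y \<longlonglongrightarrow> y" by (auto simp: Cauchy_convergent_iff convergent_def)
  show thesis
  proof
    have "self_adjoint (Y n)" for n
      by (induction n) (use x in \<open>auto simp: Y self_adjoint_simps\<close>)
    with y show "self_adjoint y" by (rule self_adjoint_lim)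
    show "norm y \<le> 1"
      by (rule LIMSEQ_le_const2[OF tendsto_norm[OF y]]) (use YT T01 order.trans in blast)
    have "(\<lambda>n. Y (Suc n)) \<longlonglongrightarrow> scaleR (1 / 2) (x + y * y)"
      unfolding Y by (intro tendsto_intros y)
    then have "y = scaleR (1 / 2) (x + y * y)" using LIMSEQ_Suc[OF y] LIMSEQ_unique by blast
    then have "scaleR 2 y = scaleR 2 (scaleR (1 / 2) (x + y * y))" by (rule arg_cong)
    then have "scaleR 2 y = x + y * y" by simp
    then show "(1 - y) * (1 - y) = 1 - x" by (simp add: algebra_simps scaleR_2)
    fix z assume "x * z = z * x"
    from comm[OF this] show "y * z = z * y"
      using tendsto_mult[OF y tendsto_const[of z]] tendsto_mult[OF tendsto_const[of z] y]
      by (simp add: LIMSEQ_unique)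
  qed
qed

text \<open>Rescaling by \<open>r = norm a\<close> writes \<open>a = r (1 - x)\<close> with
  \<open>norm x <= 1\<close>; the root is \<open>sqrt r (1 - y)\<close>, positive because
  \<open>norm y <= 1\<close>. The commutation clause serves the construction of positive and
  negative parts.\<close>

lemma positive_sqrt:
  assumes a: "positive_el a"
  obtains s where "positive_el s" "s * s = a" "\<And>z. a * z = z * a \<Longrightarrow> s * z = z * s"
proof (cases "a = 0")
  case True
  show ?thesis by (rule that[of 0]) (simp_all add: True positive_zero)
next
  case False
  define r where "r = norm a"
  have r: "r > 0" using False by (simp add: r_def)
  define x where "x = 1 - scaleR (1 / r) a"
  have "x = scaleR (1 / r) (of_real r - a)" using r by (simp add: x_def scaleR_diff_right of_real_def)
  then have "norm x \<le> 1"
    using norm_if_positive_el[OF a, of r] r by (simp add: r_def)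
  moreover have "self_adjoint x" using a by (simp add: x_def self_adjoint_simps positive_self_adjoint)
  ultimately obtain y where y: "self_adjoint y" "norm y \<le> 1" "(1 - y) * (1 - y) = 1 - x"
    "\<And>z. x * z = z * x \<Longrightarrow> y * z = z * y" using sqrt_one_minus by blast
  show ?thesis
  proof
    show "positive_el (scaleR (sqrt r) (1 - y))"
      using r y by (intro positive_scaleR positive_el_if_norm[where r=1]) (auto simp: self_adjoint_simps)
    show "scaleR (sqrt r) (1 - y) * scaleR (sqrt r) (1 - y) = a"
      using y(3) r by (simp add: x_def)
    fix z assume "a * z = z * a"
    then have "y * z = z * y" by (intro y(4)) (simp add: x_def left_diff_distrib right_diff_distrib)
    then show "scaleR (sqrt r) (1 - y) * z = z * scaleR (sqrt r) (1 - y)"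
      by (simp add: left_diff_distrib right_diff_distrib)
  qed
qed

section \<open>The cone of positive invertible elements\<close>

lemma pos_invD: "x \<in> pos_inv \<Longrightarrow> positive_el x" "x \<in> pos_inv \<Longrightarrow> invertible_el x"
  "x \<in> pos_inv \<Longrightarrow> self_adjoint x"
  by (simp_all add: pos_inv_def positive_self_adjoint)

text \<open>Invertibility is an open condition, so the spectrum keeps a gap from 0. Shifts of
  \<open>x\<close> downwards by less than \<open>d\<close> are covered by
  \<open>invertible_near\<close>, shifts upwards by positivity.\<close>

lemma pos_inv_iff: "x \<in> pos_inv \<longleftrightarrow> self_adjoint x \<and> (\<exists>d>0. positive_el (x - of_real d))"
proof
  assume x: "x \<in> pos_inv"
  note x = pos_invD[OF x]
  define K where "K = norm (inv_el x)"
  have K: "K > 0" using inv_el_right[OF x(2)] by (auto simp: K_def)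
  define d where "d = 1 / (2 * K)"
  have d: "d > 0" using K by (simp add: d_def)
  have s: "self_adjoint (x - of_real d)" using x by (simp add: self_adjoint_simps)
  have "positive_el (x - of_real d)"
    unfolding positive_iff_shifts_invertible[OF s]
  proof (intro allI impI)
    fix l :: real assume l: "l > 0"
    show "invertible_el (x - of_real d + of_real l)"
    proof (cases "l > d")
      case True
      then have "invertible_el (x + of_real (l - d))"
        using x(1) positive_iff_shifts_invertible[OF x(3)] by (metis diff_gt_0_iff_gt)
      then show ?thesis by (simp add: algebra_simps)
    next
      case False
      have "x - of_real d + of_real l - x = of_real (l - d)" by (simp add: algebra_simps)
      then have "norm (x - of_real d + of_real l - x) = \<bar>l - d\<bar>" by (metis norm_of_real)
      moreover have "\<bar>l - d\<bar> * K \<le> 1 / 2" using False l K by (simp add: d_def field_simps)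
      ultimately show ?thesis
        by (intro invertible_near(1)[OF x(2)]) (simp only: K_def[symmetric])
    qed
  qed
  with d x show "self_adjoint x \<and> (\<exists>d>0. positive_el (x - of_real d))" by blast
next
  assume "self_adjoint x \<and> (\<exists>d>0. positive_el (x - of_real d))"
  then obtain d where d: "self_adjoint x" "d > 0" "positive_el (x - of_real d)" by blast
  then have "positive_el (x - of_real d + of_real d)" by (intro positive_add positive_of_real) auto
  moreover have "invertible_el (x - of_real d + of_real d)"
    using d positive_iff_shifts_invertible[OF positive_self_adjoint[OF d(3)]] by blast
  ultimately show "x \<in> pos_inv" by (simp add: pos_inv_def)
qed

lemma positive_add_pos_inv: "positive_el x \<Longrightarrow> y \<in> pos_inv \<Longrightarrow> x + y \<in> pos_inv"
  unfolding pos_inv_iff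
  using positive_add by (metis add_diff_eq positive_self_adjoint self_adjoint_simps(4))

lemma pos_inv_one: "1 \<in> pos_inv"
  by (simp add: pos_inv_def positive_one)

lemma pos_inv_scaleR: "x \<in> pos_inv \<Longrightarrow> r > 0 \<Longrightarrow> scaleR r x \<in> pos_inv"
  by (simp add: pos_inv_def positive_scaleR invertible_scaleR)

lemma pos_inv_square: "self_adjoint x \<Longrightarrow> invertible_el x \<Longrightarrow> x * x \<in> pos_inv"
  by (simp add: pos_inv_def positive_square inv_el_mult)

lemma pos_inv_sqrt:
  assumes "a \<in> pos_inv" obtains s where "s \<in> pos_inv" "s * s = a"
proof -
  obtain s where s: "positive_el s" "s * s = a" using positive_sqrt pos_invD(1)[OF assms] by blast
  then have "invertible_el s" using invertible_commuting_factor[of s s] pos_invD(2)[OF assms] by simp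
  then show thesis using s that by (simp add: pos_inv_def)
qed

text \<open>Invertibility of the shifts follows from
  \<open>x * c * x + l = x * (c + l x^-2) * x\<close>, where the middle factor is a positive element
  plus a member of \<open>pos_inv\<close>.\<close>

lemma positive_congruence_invertible:
  assumes c: "positive_el c" and x: "self_adjoint x" "invertible_el x"
  shows "positive_el (x * c * x)"
proof -
  have s: "self_adjoint (x * c * x)" using c x positive_self_adjoint self_adjoint_simps(9) by blast
  show ?thesis unfolding positive_iff_shifts_invertible[OF s]
  proof (intro allI impI)
    fix l :: real assume l: "l > 0"
    let ?q = "scaleR l (inv_el x * inv_el x)"
    have "?q \<in> pos_inv"
      using x l by (intro pos_inv_scaleR pos_inv_square self_adjoint_inv_el invertible_inv_el)
    then have "invertible_el (c + ?q)" using c positive_add_pos_inv pos_invD(2) by blast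
    then have "invertible_el (x * (c + ?q) * x)" using x by (intro inv_el_mult)
    also have "x * (c + ?q) * x = x * c * x + of_real l"
      using x by (simp add: algebra_simps inv_el_simps of_real_def mult.assoc)
    finally show "invertible_el (x * c * x + of_real l)" .
  qed
qed

lemma positive_congruence_iff:
  assumes "self_adjoint x" "invertible_el x"
  shows "positive_el (x * c * x) \<longleftrightarrow> positive_el c"
proof
  assume "positive_el (x * c * x)"
  from positive_congruence_invertible[OF this self_adjoint_inv_el[OF assms] invertible_inv_el[OF assms(2)]]
  have "positive_el (inv_el x * (x * c * x) * inv_el x)" .
  also have "inv_el x * (x * c * x) * inv_el x = c"
    using assms(2) by (simp add: mult.assoc inv_el_simps)
  finally show "positive_el c" .
qed (use assms positive_congruence_invertible in blast)

lemma pos_inv_congruence: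
  assumes "c \<in> pos_inv" "x \<in> pos_inv" shows "x * c * x \<in> pos_inv"
  using assms by (simp add: pos_inv_def positive_congruence_iff positive_self_adjoint inv_el_mult)

lemma pos_inv_inv_el:
  assumes "x \<in> pos_inv" shows "inv_el x \<in> pos_inv"
proof -
  note x = pos_invD[OF assms]
  have "positive_el (inv_el x * x * inv_el x)"
    using x by (intro positive_congruence_invertible self_adjoint_inv_el invertible_inv_el)
  then show ?thesis using x by (simp add: pos_inv_def inv_el_simps mult.assoc invertible_inv_el)
qed

section \<open>The Thompson metric\<close>

lemma positive_of_real_iff: "positive_el (of_real r :: 'a::cstar_algebra) \<longleftrightarrow> r \<ge> 0"
proof
  assume p: "positive_el (of_real r :: 'a)"
  show "r \<ge> 0"
  proof (rule ccontr)
    assume "\<not> r \<ge> 0"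
    then have "positive_el (- of_real r :: 'a)" using positive_of_real[of "- r"] by simp
    with p have "(of_real r :: 'a) = 0" by (rule positive_antisym)
    with \<open>\<not> r \<ge> 0\<close> show False by simp
  qed
qed (rule positive_of_real)

text \<open>The admissible \<open>t\<close> form a nonempty, upward closed set bounded away from 0,
  and the cone is closed. So the infimum is positive and attained.\<close>

lemma M_ratio_pos_le_iff:
  assumes x: "x \<in> pos_inv" and y: "y \<in> pos_inv"
  shows "M_ratio x y > 0"
    and "s > 0 \<Longrightarrow> M_ratio x y \<le> s \<longleftrightarrow> positive_el (scaleR s y - x)"
proof -
  define S where "S = {t::real. t > 0 \<and> positive_el (scaleR t y - x)}"
  have M: "M_ratio x y = Inf S" by (simp add: M_ratio_def S_def cstar_le_def)
  obtain dx where dx: "dx > 0" "positive_el (x - of_real dx)" using x by (auto simp: pos_inv_iff)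
  obtain dy where dy: "dy > 0" "positive_el (y - of_real dy)" using y by (auto simp: pos_inv_iff)
  have xy0: "norm x > 0" "norm y > 0"
    using inv_el_right[OF pos_invD(2)[OF x]] inv_el_right[OF pos_invD(2)[OF y]] by auto
  have xn: "positive_el (of_real (norm z) - z)" if "z \<in> pos_inv" for z :: 'a
    using positive_norm_le_iff[OF pos_invD(1)[OF that], of "norm z"] by simp
  have up: "t' \<in> S" if "t \<in> S" "t \<le> t'" for t t'
  proof -
    have "positive_el ((scaleR t y - x) + scaleR (t' - t) y)"
      using that pos_invD(1)[OF y] by (intro positive_add positive_scaleR) (auto simp: S_def)
    also have "(scaleR t y - x) + scaleR (t' - t) y = scaleR t' y - x" by (simp add: algebra_simps)
    finally show ?thesis using that by (simp add: S_def)
  qed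
  \<comment> \<open>An admissible value comes from
    \<open>x <= norm x <= (norm x / dy) y\<close>.\<close>
  have "positive_el (scaleR (norm x / dy) (y - of_real dy) + (of_real (norm x) - x))"
    using dy xn[OF x] by (intro positive_add positive_scaleR) auto
  also have "scaleR (norm x / dy) (y - of_real dy) + (of_real (norm x) - x) = scaleR (norm x / dy) y - x"
    using dy by (simp add: scaleR_diff_right of_real_def)
  finally have "norm x / dy \<in> S" using dy xy0 by (simp add: S_def)
  then have ne: "S \<noteq> {}" by blast
  \<comment> \<open>Here the chain is \<open>dx <= x <= t y <= t * norm y\<close>.\<close>
  have low: "dx / norm y \<le> t" if "t \<in> S" for t
  proof -
    have "positive_el (scaleR t (of_real (norm y) - y) + (scaleR t y - x) + (x - of_real dx))"
      using that dx xn[OF y] by (intro positive_add positive_scaleR) (auto simp: S_def)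
    also have "scaleR t (of_real (norm y) - y) + (scaleR t y - x) + (x - of_real dx) = of_real (t * norm y - dx)"
      by (simp add: algebra_simps of_real_def)
    finally show ?thesis unfolding positive_of_real_iff using xy0 by (simp add: field_simps)
  qed
  have "dx / norm y \<le> Inf S" by (rule cInf_greatest[OF ne low])
  moreover have "dx / norm y > 0" using dx xy0 by simp
  ultimately show "M_ratio x y > 0" unfolding M by linarith
  assume s: "s > 0"
  show "M_ratio x y \<le> s \<longleftrightarrow> positive_el (scaleR s y - x)"
  proof
    assume "positive_el (scaleR s y - x)"
    then have "s \<in> S" using s by (simp add: S_def)
    then show "M_ratio x y \<le> s" unfolding M by (rule cInf_lower) (rule bdd_belowI[OF low])
  next
    assume le: "M_ratio x y \<le> s"
    show "positive_el (scaleR s y - x)"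
    proof (rule positive_lim)
      show "(\<lambda>n. scaleR (s + inverse (real (Suc n))) y - x) \<longlonglongrightarrow> scaleR s y - x"
        by (intro tendsto_intros LIMSEQ_inverse_real_of_nat_add)
      fix n
      have "Inf S < s + inverse (real (Suc n))" using le unfolding M by (simp add: add.commute add_pos_nonneg le_less_trans less_add_same_cancel2)
      then obtain t where "t \<in> S" "t < s + inverse (real (Suc n))" using cInf_lessD[OF ne] by blast
      then have "s + inverse (real (Suc n)) \<in> S" using up by fastforce
      then show "positive_el (scaleR (s + inverse (real (Suc n))) y - x)" by (simp add: S_def)
    qed
  qed
qed

text \<open>From here on the metric is handled through these two order inequalities rather than
  through infima and logarithms.\<close>

lemma thompson_dist_le_iff:
  assumes "x \<in> pos_inv" "y \<in> pos_inv"
  shows "thompson_dist x y \<le> e \<longleftrightarrow>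
    positive_el (scaleR (exp e) y - x) \<and> positive_el (scaleR (exp e) x - y)"
proof -
  let ?m = "max (M_ratio x y) (M_ratio y x)"
  have "?m > 0" using M_ratio_pos_le_iff(1)[OF assms] by simp
  then have "thompson_dist x y \<le> e \<longleftrightarrow> ?m \<le> exp e"
    unfolding thompson_dist_def by (metis exp_le_cancel_iff exp_ln)
  then show ?thesis using M_ratio_pos_le_iff(2)[of x y "exp e"] M_ratio_pos_le_iff(2)[of y x "exp e"] assms by simp
qed

section \<open>Metric axioms and basic isometries\<close>

lemma real_eq_by_upper_bounds: "(\<And>e. (a::real) \<le> e \<longleftrightarrow> b \<le> e) \<Longrightarrow> a = b"
  by (meson order.antisym order_refl)

lemma thompson_dist_commute: "thompson_dist x y = thompson_dist y x"
  by (simp add: thompson_dist_def max.commute)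

text \<open>A negative distance \<open>e\<close> would give \<open>y <= exp (2 e) y\<close> with
  \<open>exp (2 e) < 1\<close>, which forces \<open>y = 0\<close>.\<close>

lemma thompson_dist_nonneg:
  assumes x: "x \<in> pos_inv" and y: "y \<in> pos_inv" shows "thompson_dist x y \<ge> 0"
proof (rule ccontr)
  define e where "e = thompson_dist x y"
  assume "\<not> thompson_dist x y \<ge> 0"
  then have e: "e < 0" by (simp add: e_def)
  have "positive_el (scaleR (exp e) (scaleR (exp e) y - x) + (scaleR (exp e) x - y))"
    using thompson_dist_le_iff[OF x y, of e] by (intro positive_add positive_scaleR) (auto simp: e_def)
  also have "scaleR (exp e) (scaleR (exp e) y - x) + (scaleR (exp e) x - y) = - scaleR (1 - exp e * exp e) y"
    by (simp add: algebra_simps)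
  finally have "positive_el (- scaleR (1 - exp e * exp e) y)" .
  moreover have "1 - exp e * exp e > 0" using e by (simp add: exp_add[symmetric])
  ultimately have "scaleR (1 - exp e * exp e) y = 0"
    using positive_antisym positive_scaleR pos_invD(1)[OF y] less_imp_le by metis
  then have "y = 0" using \<open>1 - exp e * exp e > 0\<close> by simp
  then show False using inv_el_right[OF pos_invD(2)[OF y]] by simp
qed

lemma thompson_dist_triangle:
  assumes x: "x \<in> pos_inv" and y: "y \<in> pos_inv" and z: "z \<in> pos_inv"
  shows "thompson_dist x z \<le> thompson_dist x y + thompson_dist y z"
proof -
  have *: "positive_el (scaleR (exp (a + b)) w - u)"
    if "positive_el (scaleR (exp a) v - u)" "positive_el (scaleR (exp b) w - v)" for a b and u v w :: 'a
  proof -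
    have "positive_el (scaleR (exp a) (scaleR (exp b) w - v) + (scaleR (exp a) v - u))"
      using that by (intro positive_add positive_scaleR) auto
    then show ?thesis by (simp add: algebra_simps exp_add)
  qed
  let ?a = "thompson_dist x y" and ?b = "thompson_dist y z"
  have "positive_el (scaleR (exp ?a) y - x)" "positive_el (scaleR (exp ?a) x - y)"
    "positive_el (scaleR (exp ?b) z - y)" "positive_el (scaleR (exp ?b) y - z)"
    using thompson_dist_le_iff[OF x y, of ?a] thompson_dist_le_iff[OF y z, of ?b] by auto
  then show ?thesis
    unfolding thompson_dist_le_iff[OF x z] using *[of ?a y x ?b z] *[of ?b y z ?a x]
    by (simp add: add.commute)
qed

lemma thompson_dist_self: assumes "x \<in> pos_inv" shows "thompson_dist x x = 0"
  using thompson_dist_le_iff[OF assms assms, of 0] thompson_dist_nonneg[OF assms assms]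
  by (simp add: positive_zero)

lemma thompson_dist_zero:
  assumes x: "x \<in> pos_inv" and y: "y \<in> pos_inv" and 0: "thompson_dist x y = 0" shows "x = y"
  using thompson_dist_le_iff[OF x y, of 0] positive_antisym[of "x - y"] 0 by simp

lemma thompson_dist_congruence:
  assumes x: "x \<in> pos_inv" and y: "y \<in> pos_inv" and c: "c \<in> pos_inv"
  shows "thompson_dist (c * x * c) (c * y * c) = thompson_dist x y"
proof (rule real_eq_by_upper_bounds)
  fix e
  have "positive_el (scaleR (exp e) (c * v * c) - c * u * c) \<longleftrightarrow> positive_el (scaleR (exp e) v - u)" for u v
    using positive_congruence_iff[OF pos_invD(3,2)[OF c], of "scaleR (exp e) v - u"]
    by (simp add: algebra_simps)
  then show "thompson_dist (c * x * c) (c * y * c) \<le> e \<longleftrightarrow> thompson_dist x y \<le> e"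
    using x y c by (simp add: thompson_dist_le_iff pos_inv_congruence)
qed

lemma inv_el_congruence:
  assumes "x \<in> pos_inv" "c \<in> pos_inv"
  shows "inv_el (c * x * c) = inv_el c * inv_el x * inv_el c"
  using assms by (simp add: inv_el_mult pos_invD mult.assoc)

lemma pos_inv_sqrt_cancel:
  assumes "s \<in> pos_inv"
  shows "inv_el s * (s * s) * inv_el s = 1" "s * inv_el (s * s) * s = 1"
  using pos_invD(2)[OF assms] by (simp_all add: inv_el_mult inv_el_simps mult.assoc)

text \<open>Congruence by the inverse root of \<open>y\<close> reduces to \<open>k <= 1\<close>, and
  congruence by the inverse root of \<open>k\<close> turns this into \<open>1 <= k^-1\<close>.
  Undoing the first congruence gives the claim.\<close>

lemma positive_diff_inv_el:
  assumes x: "x \<in> pos_inv" and y: "y \<in> pos_inv" and le: "positive_el (y - x)"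
  shows "positive_el (inv_el x - inv_el y)"
proof -
  obtain s where s: "s \<in> pos_inv" "s * s = y" using pos_inv_sqrt[OF y] .
  note si = pos_inv_inv_el[OF s(1)]
  let ?k = "inv_el s * x * inv_el s"
  have k: "?k \<in> pos_inv" using x si by (rule pos_inv_congruence)
  obtain t where t: "t \<in> pos_inv" "t * t = ?k" using pos_inv_sqrt[OF k] .
  note it = pos_inv_inv_el[OF t(1)]
  have "positive_el (inv_el s * (y - x) * inv_el s)"
    using le si by (simp add: positive_congruence_iff pos_invD)
  also have "inv_el s * (y - x) * inv_el s = 1 - t * t"
    using pos_inv_sqrt_cancel(1)[OF s(1)] by (simp add: s(2) t(2) algebra_simps)
  finally have "positive_el (inv_el t * (1 - t * t) * inv_el t)"
    using it by (simp add: positive_congruence_iff pos_invD)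
  also have "inv_el t * (1 - t * t) * inv_el t = inv_el (t * t) - 1"
    using pos_inv_sqrt_cancel(1)[OF t(1)] pos_invD(2)[OF t(1)] by (simp add: algebra_simps inv_el_mult)
  finally have "positive_el (inv_el s * (inv_el ?k - 1) * inv_el s)"
    using si t(2) by (simp add: positive_congruence_iff pos_invD)
  also have "inv_el ?k = s * inv_el x * s"
    using x s(1) si by (simp add: inv_el_congruence inv_el_inv_el pos_invD)
  also have "inv_el s * (s * inv_el x * s - 1) * inv_el s = inv_el x - inv_el y"
    using pos_invD(2)[OF s(1)] by (simp add: inv_el_mult s(2)[symmetric] algebra_simps inv_el_simps)
  finally show ?thesis .
qed

lemma thompson_dist_inv_el:
  assumes x: "x \<in> pos_inv" and y: "y \<in> pos_inv"
  shows "thompson_dist (inv_el x) (inv_el y) = thompson_dist x y"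
proof -
  have *: "positive_el (scaleR (exp e) (inv_el u) - inv_el v)"
    if u: "u \<in> pos_inv" and v: "v \<in> pos_inv" and p: "positive_el (scaleR (exp e) v - u)" for e and u v :: 'a
  proof -
    have "positive_el (inv_el u - inv_el (scaleR (exp e) v))"
      using u v p by (intro positive_diff_inv_el pos_inv_scaleR) auto
    then have "positive_el (scaleR (exp e) (inv_el u - inv_el (scaleR (exp e) v)))"
      by (rule positive_scaleR) simp
    then show ?thesis using v by (simp add: scaleR_diff_right invertible_scaleR pos_invD)
  qed
  have le: "thompson_dist (inv_el u) (inv_el v) \<le> thompson_dist u v"
    if u: "u \<in> pos_inv" and v: "v \<in> pos_inv" for u v :: 'a
    using thompson_dist_le_iff[OF u v, of "thompson_dist u v"] *[OF u v] *[OF v u] u v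
    by (simp add: thompson_dist_le_iff pos_inv_inv_el)
  show ?thesis
    using le[OF x y] le[OF pos_inv_inv_el[OF x] pos_inv_inv_el[OF y]] x y by (simp add: inv_el_inv_el pos_invD)
qed

text \<open>The lower order bound on \<open>x\<close> becomes an upper bound on
  \<open>inv_el x\<close> after congruence by the inverse root of \<open>x\<close>; upper bounds on
  positive elements are norm bounds.\<close>

lemma thompson_dist_one_le_iff:
  assumes x: "x \<in> pos_inv"
  shows "thompson_dist 1 x \<le> e \<longleftrightarrow> norm x \<le> exp e \<and> norm (inv_el x) \<le> exp e"
proof -
  obtain s where s: "s \<in> pos_inv" "s * s = x" using pos_inv_sqrt[OF x] .
  note si = pos_inv_inv_el[OF s(1)]
  have "inv_el s * (scaleR (exp e) x - 1) * inv_el s = of_real (exp e) - inv_el x"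
    using pos_inv_sqrt_cancel(1)[OF s(1)] pos_invD(2)[OF s(1)]
    by (simp add: s(2)[symmetric] algebra_simps inv_el_mult of_real_def)
  then have "positive_el (scaleR (exp e) x - 1) \<longleftrightarrow> positive_el (of_real (exp e) - inv_el x)"
    using positive_congruence_iff[OF pos_invD(3,2)[OF si], of "scaleR (exp e) x - 1"] by simp
  then show ?thesis
    using x pos_inv_inv_el[OF x] by (auto simp: thompson_dist_le_iff pos_inv_one positive_norm_le_iff pos_invD of_real_def)
qed

lemma thompson_dist_one_square:
  assumes x: "x \<in> pos_inv" shows "thompson_dist 1 (x * x) = 2 * thompson_dist 1 x"
proof -
  have "thompson_dist 1 (x * x) / 2 = thompson_dist 1 x"
  proof (rule real_eq_by_upper_bounds)
    fix e
    have sq: "norm (z * z) \<le> exp (2 * e) \<longleftrightarrow> norm z \<le> exp e" if "z \<in> pos_inv" for z :: 'a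
      using norm_self_adjoint_square[OF pos_invD(3)[OF that]]
      by (metis exp_double exp_ge_zero norm_ge_zero power2_eq_square power2_le_iff_abs_le abs_norm_cancel)
    have "thompson_dist 1 (x * x) / 2 \<le> e \<longleftrightarrow> thompson_dist 1 (x * x) \<le> 2 * e" by linarith
    also have "\<dots> \<longleftrightarrow> thompson_dist 1 x \<le> e"
      using x sq[OF x] sq[OF pos_inv_inv_el[OF x]]
      by (simp add: thompson_dist_one_le_iff pos_inv_square pos_invD inv_el_mult)
    finally show "thompson_dist 1 (x * x) / 2 \<le> e \<longleftrightarrow> thompson_dist 1 x \<le> e" .
  qed
  then show ?thesis by simp
qed

section \<open>Reflections and dilations\<close>

text \<open>The point reflection at \<open>m\<close> in the cone viewed as a symmetric space:
  \<open>m\<close> is the geometric mean of \<open>x\<close> and its image.\<close>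

definition reflect :: "'a::cstar_algebra \<Rightarrow> 'a \<Rightarrow> 'a" where
  "reflect m x = m * inv_el x * m"

lemma reflect_pos_inv: "m \<in> pos_inv \<Longrightarrow> x \<in> pos_inv \<Longrightarrow> reflect m x \<in> pos_inv"
  by (simp add: reflect_def pos_inv_congruence pos_inv_inv_el)

lemma reflect_reflect: "m \<in> pos_inv \<Longrightarrow> x \<in> pos_inv \<Longrightarrow> reflect m (reflect m x) = x"
  by (simp add: reflect_def inv_el_congruence pos_inv_inv_el inv_el_inv_el pos_invD)
    (simp add: mult.assoc inv_el_simps pos_invD)

lemma reflect_self: "m \<in> pos_inv \<Longrightarrow> reflect m m = m"
  by (simp add: reflect_def inv_el_simps pos_invD)

lemma reflect_isometry:
  "m \<in> pos_inv \<Longrightarrow> x \<in> pos_inv \<Longrightarrow> y \<in> pos_inv \<Longrightarrow>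
    thompson_dist (reflect m x) (reflect m y) = thompson_dist x y"
  by (simp add: reflect_def thompson_dist_congruence thompson_dist_inv_el pos_inv_inv_el)

text \<open>At the centre 1, congruence by a root of \<open>z\<close> carries the pair
  \<open>inv_el z\<close>, \<open>z\<close> to \<open>1\<close>, \<open>z * z\<close>, and squaring
  doubles the distance from 1. Congruence by the inverse root of \<open>m\<close> moves any centre
  to 1.\<close>

lemma thompson_dist_reflect:
  assumes m: "m \<in> pos_inv" and x: "x \<in> pos_inv"
  shows "thompson_dist (reflect m x) x = 2 * thompson_dist m x"
proof -
  have base: "thompson_dist (inv_el z) z = 2 * thompson_dist 1 z" if z: "z \<in> pos_inv" for z :: 'a
  proof -
    obtain s where s: "s \<in> pos_inv" "s * s = z" using pos_inv_sqrt[OF z] .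
    have "thompson_dist (inv_el z) z = thompson_dist (s * inv_el z * s) (s * z * s)"
      using z s by (simp add: thompson_dist_congruence pos_inv_inv_el)
    also have "\<dots> = thompson_dist 1 (z * z)"
      using pos_inv_sqrt_cancel(2)[OF s(1)] by (simp add: s(2)[symmetric] mult.assoc)
    finally show ?thesis using z by (simp add: thompson_dist_one_square)
  qed
  obtain s where s: "s \<in> pos_inv" "s * s = m" using pos_inv_sqrt[OF m] .
  note si = pos_inv_inv_el[OF s(1)]
  let ?z = "inv_el s * x * inv_el s"
  have z: "?z \<in> pos_inv" using x si by (rule pos_inv_congruence)
  have "thompson_dist (reflect m x) x = thompson_dist (inv_el s * reflect m x * inv_el s) ?z"
    using m x si by (simp add: thompson_dist_congruence reflect_pos_inv)
  also have "inv_el s * reflect m x * inv_el s = s * inv_el x * s"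
    using pos_invD(2)[OF s(1)] by (simp add: reflect_def s(2)[symmetric] mult.assoc inv_el_simps)
  also have "s * inv_el x * s = inv_el ?z"
    using x s(1) si by (simp add: inv_el_congruence inv_el_inv_el pos_invD)
  also have "thompson_dist (inv_el ?z) ?z = 2 * thompson_dist 1 ?z" using z by (rule base)
  also have "thompson_dist 1 ?z = thompson_dist (inv_el s * m * inv_el s) ?z"
    using pos_inv_sqrt_cancel(1)[OF s(1)] by (simp add: s(2))
  also have "\<dots> = thompson_dist m x" using m x si by (simp add: thompson_dist_congruence)
  finally show ?thesis .
qed

text \<open>The witness is the geometric mean \<open>s (s^-1 b s^-1)^(1/2) s\<close> of
  \<open>a\<close> and \<open>b\<close>, where \<open>s\<close> is a root of
  \<open>a\<close>.\<close>

lemma reflect_exists: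
  assumes a: "a \<in> pos_inv" and b: "b \<in> pos_inv"
  obtains m where "m \<in> pos_inv" "reflect m a = b"
proof -
  obtain s where s: "s \<in> pos_inv" "s * s = a" using pos_inv_sqrt[OF a] .
  note si = pos_inv_inv_el[OF s(1)]
  obtain r where r: "r \<in> pos_inv" "r * r = inv_el s * b * inv_el s"
    using pos_inv_sqrt[OF pos_inv_congruence[OF b si]] .
  show thesis
  proof
    show "s * r * s \<in> pos_inv" using s r by (simp add: pos_inv_congruence)
    have "reflect (s * r * s) a = s * (r * r) * s"
      using pos_invD(2)[OF s(1)] by (simp add: reflect_def s(2)[symmetric] inv_el_mult inv_el_simps mult.assoc)
    also have "\<dots> = b" using pos_invD(2)[OF s(1)] by (simp add: r(2) mult.assoc inv_el_simps)
    finally show "reflect (s * r * s) a = b" .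
  qed
qed

text \<open>Vogt's and Vaisala's argument: conjugating by the reflection produces from an isometry fixing
  \<open>a\<close> and \<open>b\<close> another one that moves the midpoint twice as far.\<close>

lemma isometry_fixes_midpoint:
  fixes T :: "'a::cstar_algebra \<Rightarrow> 'a"
  assumes a: "a \<in> pos_inv" and m: "m \<in> pos_inv" and b: "b = reflect m a"
    and T: "bij_betw T pos_inv pos_inv"
      "\<And>x y. x \<in> pos_inv \<Longrightarrow> y \<in> pos_inv \<Longrightarrow> thompson_dist (T x) (T y) = thompson_dist x y"
      "T a = a" "T b = b"
  shows "T m = m"
proof -
  define F where "F = {T :: 'a \<Rightarrow> 'a. bij_betw T pos_inv pos_inv \<and>
    (\<forall>x\<in>pos_inv. \<forall>y\<in>pos_inv. thompson_dist (T x) (T y) = thompson_dist x y) \<and> T a = a \<and> T b = b}"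
  have bP: "b \<in> pos_inv" using a m by (simp add: b reflect_pos_inv)
  have bound: "thompson_dist (U m) m \<le> 2 * thompson_dist a m" if "U \<in> F" for U
  proof -
    have U: "U m \<in> pos_inv" "thompson_dist (U m) (U a) = thompson_dist m a" "U a = a"
      using that a m unfolding F_def bij_betw_def by (blast, metis (mono_tags, lifting) mem_Collect_eq, blast)
    then show ?thesis using thompson_dist_triangle[OF U(1) a m] thompson_dist_commute[of a m] by simp
  qed
  have bdd: "bdd_above ((\<lambda>U. thompson_dist (U m) m) ` F)" by (rule bdd_aboveI2) (rule bound)
  have double: "2 * thompson_dist (U m) m \<le> (SUP U\<in>F. thompson_dist (U m) m)" if UF: "U \<in> F" for U
  proof -
    define V where "V = inv_into pos_inv U"
    \<comment> \<open>The reflection swaps \<open>a\<close> and \<open>b\<close>, so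
      \<open>W\<close> fixes both again. Since \<open>V\<close> is the inverse of \<open>U\<close>,
      \<open>W\<close> moves \<open>m\<close> as far as the reflection moves \<open>U m\<close>,
      that is, by twice the displacement under \<open>U\<close>.\<close>
    define W where "W = (\<lambda>x. V (reflect m (U (reflect m x))))"
    have U: "bij_betw U pos_inv pos_inv" "\<And>x y. x \<in> pos_inv \<Longrightarrow> y \<in> pos_inv \<Longrightarrow>
        thompson_dist (U x) (U y) = thompson_dist x y" "U a = a" "U b = b"
      using UF by (auto simp: F_def)
    have UP: "U x \<in> pos_inv" if "x \<in> pos_inv" for x using U(1) that by (auto simp: bij_betw_def)
    have V: "bij_betw V pos_inv pos_inv" unfolding V_def using U(1) by (rule bij_betw_inv_into)
    have UV: "U (V x) = x" and VP: "V x \<in> pos_inv" if "x \<in> pos_inv" for x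
      using U(1) V that by (auto simp: V_def bij_betw_def f_inv_into_f)
    have VU: "V (U x) = x" if "x \<in> pos_inv" for x
      using U(1) that by (simp add: V_def bij_betw_def inv_into_f_f)
    have Viso: "thompson_dist (V x) (V y) = thompson_dist x y" if "x \<in> pos_inv" "y \<in> pos_inv" for x y
      using U(2)[OF VP[OF that(1)] VP[OF that(2)]] that by (simp add: UV)
    have S: "bij_betw (reflect m) pos_inv pos_inv"
      by (rule bij_betw_byWitness[where f'="reflect m"]) (use m in \<open>auto simp: reflect_reflect reflect_pos_inv\<close>)
    have "bij_betw W pos_inv pos_inv"
      using bij_betw_trans[OF bij_betw_trans[OF bij_betw_trans[OF S U(1)] S] V] by (simp add: W_def comp_def)
    moreover have "thompson_dist (W x) (W y) = thompson_dist x y" if "x \<in> pos_inv" "y \<in> pos_inv" for x y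
      using that m by (simp add: W_def Viso reflect_isometry reflect_pos_inv UP U(2))
    moreover have "reflect m b = a" using a m by (simp add: b reflect_reflect)
    then have "W a = a" "W b = b"
      using U(3,4) VU[OF a] VU[OF bP] by (simp_all add: W_def b[symmetric])
    ultimately have "W \<in> F" by (simp add: F_def)
    then have "thompson_dist (W m) m \<le> (SUP U\<in>F. thompson_dist (U m) m)" using bdd by (rule cSUP_upper)
    moreover have "thompson_dist (W m) m = thompson_dist (reflect m (U m)) (U m)"
      using Viso[of "reflect m (U m)" "U m"] m by (simp add: W_def reflect_self VU UP reflect_pos_inv)
    ultimately show ?thesis
      using thompson_dist_reflect[OF m UP[OF m]] thompson_dist_commute[of m "U m"] by simp
  qed
  \<comment> \<open>The finite supremum of all displacements is at most half of itself, hence not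
    positive.\<close>
  have TF: "T \<in> F" using T by (simp add: F_def)
  then have "(SUP U\<in>F. thompson_dist (U m) m) \<le> (SUP U\<in>F. thompson_dist (U m) m) / 2"
    using double by (intro cSUP_least) (auto simp: field_simps)
  then have "thompson_dist (T m) m \<le> 0" using double[OF TF] by simp
  moreover have "T m \<in> pos_inv" using T(1) m by (auto simp: bij_betw_def)
  ultimately show ?thesis using thompson_dist_nonneg[of "T m" m] thompson_dist_zero[of "T m" m] m by simp
qed

lemma dilation_bij:
  fixes \<phi> :: "'a::cstar_algebra \<Rightarrow> 'b::cstar_algebra"
  assumes "\<phi> ` pos_inv = pos_inv" and "\<gamma> > 0"
    and d: "\<And>x y. x \<in> pos_inv \<Longrightarrow> y \<in> pos_inv \<Longrightarrow> thompson_dist (\<phi> x) (\<phi> y) = \<gamma> * thompson_dist x y"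
  shows "bij_betw \<phi> pos_inv pos_inv"
proof (rule bij_betw_imageI)
  show "inj_on \<phi> pos_inv"
  proof (rule inj_onI)
    fix x y assume xy: "x \<in> pos_inv" "y \<in> pos_inv" "\<phi> x = \<phi> y"
    then have "\<phi> y \<in> pos_inv" using assms(1) by blast
    then have "\<gamma> * thompson_dist x y = 0" using d[OF xy(1,2)] xy(3) thompson_dist_self[of "\<phi> y"] by simp
    then show "x = y" using thompson_dist_zero xy assms(2) by simp
  qed
qed fact

text \<open>Let \<open>m'\<close> be a centre whose reflection exchanges \<open>\<phi> a\<close> and
  \<open>\<phi> b\<close>. Going through \<open>\<phi>\<close>, this reflection, the inverse of
  \<open>\<phi>\<close> and the reflection at \<open>m\<close> is an isometry, as the factors
  cancel, and it fixes \<open>a\<close> and \<open>b\<close>; so it fixes \<open>m\<close>. Then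
  \<open>\<phi> m\<close> is fixed by the reflection at \<open>m'\<close>, whose only fixed point is
  its centre.\<close>

lemma dilation_reflect:
  fixes \<phi> :: "'a::cstar_algebra \<Rightarrow> 'b::cstar_algebra"
  assumes im: "\<phi> ` pos_inv = pos_inv" and g: "\<gamma> > 0"
    and d: "\<And>x y. x \<in> pos_inv \<Longrightarrow> y \<in> pos_inv \<Longrightarrow> thompson_dist (\<phi> x) (\<phi> y) = \<gamma> * thompson_dist x y"
    and a: "a \<in> pos_inv" and m: "m \<in> pos_inv"
  shows "\<phi> (reflect m a) = reflect (\<phi> m) (\<phi> a)"
proof -
  define b where "b = reflect m a"
  define V where "V = inv_into pos_inv \<phi>"
  have bij: "bij_betw \<phi> pos_inv pos_inv" using dilation_bij[OF im g d] .
  have V: "bij_betw V pos_inv pos_inv" unfolding V_def using bij by (rule bij_betw_inv_into)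
  have P: "\<phi> x \<in> pos_inv" if "x \<in> pos_inv" for x using im that by blast
  have UV: "\<phi> (V x) = x" and VP: "V x \<in> pos_inv" if "x \<in> pos_inv" for x
    using bij V that by (auto simp: V_def bij_betw_def f_inv_into_f)
  have VU: "V (\<phi> x) = x" if "x \<in> pos_inv" for x
    using bij that by (simp add: V_def bij_betw_def inv_into_f_f)
  have Viso: "\<gamma> * thompson_dist (V x) (V y) = thompson_dist x y" if "x \<in> pos_inv" "y \<in> pos_inv" for x y
    using d[OF VP[OF that(1)] VP[OF that(2)]] that by (simp add: UV)
  have b: "b \<in> pos_inv" using a m by (simp add: b_def reflect_pos_inv)
  obtain m' where m': "m' \<in> pos_inv" "reflect m' (\<phi> a) = \<phi> b" using reflect_exists[OF P[OF a] P[OF b]] .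
  then have m'b: "reflect m' (\<phi> b) = \<phi> a" using reflect_reflect[OF m'(1) P[OF a]] by simp
  have S: "bij_betw (reflect c) pos_inv pos_inv" if "c \<in> pos_inv" for c :: "'c::cstar_algebra"
    by (rule bij_betw_byWitness[where f'="reflect c"]) (use that in \<open>auto simp: reflect_reflect reflect_pos_inv\<close>)
  have "bij_betw (\<lambda>x. reflect m (V (reflect m' (\<phi> x)))) pos_inv pos_inv"
    using bij_betw_trans[OF bij_betw_trans[OF bij_betw_trans[OF bij S[OF m'(1)]] V] S[OF m]] by (simp add: comp_def)
  then have fix_m: "reflect m (V (reflect m' (\<phi> m))) = m"
  proof (rule isometry_fixes_midpoint[OF a m b_def])
    show "thompson_dist (reflect m (V (reflect m' (\<phi> x)))) (reflect m (V (reflect m' (\<phi> y)))) = thompson_dist x y"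
      if xy: "x \<in> pos_inv" "y \<in> pos_inv" for x y
    proof -
      have "\<gamma> * thompson_dist (reflect m (V (reflect m' (\<phi> x)))) (reflect m (V (reflect m' (\<phi> y)))) = \<gamma> * thompson_dist x y"
        using xy m m' P by (simp add: reflect_isometry VP reflect_pos_inv Viso d)
      then show ?thesis using g by simp
    qed
    show "reflect m (V (reflect m' (\<phi> a))) = a" using VU[OF b] m' a m by (simp add: b_def reflect_reflect)
    show "reflect m (V (reflect m' (\<phi> b))) = b" using VU[OF a] m'b by (simp add: b_def)
  qed
  have rP: "reflect m' (\<phi> m) \<in> pos_inv" using m'(1) P[OF m] by (rule reflect_pos_inv)
  have "V (reflect m' (\<phi> m)) = m"
    using reflect_reflect[OF m VP[OF rP]] fix_m reflect_self[OF m] by simp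
  then have "reflect m' (\<phi> m) = \<phi> m" using UV[OF rP] by simp
  then have "thompson_dist m' (\<phi> m) = 0"
    using thompson_dist_reflect[OF m'(1) P[OF m]] thompson_dist_self[OF P[OF m]] by simp
  then have "m' = \<phi> m" using thompson_dist_zero m' P[OF m] by blast
  then show ?thesis using m'(2) by (simp add: b_def)
qed

section \<open>First-order asymptotics\<close>

definition commutator :: "'a::ring \<Rightarrow> 'a \<Rightarrow> 'a" where
  "commutator x y = x * y - y * x"

text \<open>The order bounds read \<open>exp (- e) <= w <= exp e\<close>. As
  \<open>exp e + exp (- e) >= 2\<close>, the lower one is no further from 1 than the upper
  one.\<close>

lemma norm_minus_one_le:
  assumes w: "w \<in> pos_inv" shows "norm (w - 1) \<le> exp (thompson_dist 1 w) - 1"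
proof -
  let ?e = "thompson_dist 1 w"
  have e: "?e \<ge> 0" using thompson_dist_nonneg[OF pos_inv_one w] .
  have p: "positive_el (scaleR (exp ?e) w - 1)" "positive_el (scaleR (exp ?e) 1 - w)"
    using thompson_dist_le_iff[OF pos_inv_one w, of ?e] by auto
  have "exp ?e + exp (- ?e) - 2 \<ge> 0"
    using exp_ge_add_one_self[of ?e] exp_ge_add_one_self[of "- ?e"] by linarith
  then have "positive_el (scaleR (exp (- ?e)) (scaleR (exp ?e) w - 1) + of_real (exp ?e + exp (- ?e) - 2))"
    by (intro positive_add positive_scaleR p positive_of_real) auto
  also have "scaleR (exp (- ?e)) (scaleR (exp ?e) w - 1) + of_real (exp ?e + exp (- ?e) - 2) =
      of_real (exp ?e - 1) + (w - 1)"
    by (simp add: algebra_simps exp_minus_inverse of_real_def scaleR_2 flip: exp_add)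
  finally show ?thesis
    using p(2) w e norm_le_iff_positive[of "w - 1" "exp ?e - 1"]
    by (simp add: self_adjoint_simps pos_invD of_real_def algebra_simps)
qed

text \<open>With \<open>h = norm (w - 1)\<close>, the distance lies between
  \<open>ln (1 + h)\<close>, by \<open>norm_minus_one_le\<close>, and \<open>- ln (1 - h)\<close>,
  by the Neumann series.\<close>

lemma thompson_dist_one_near:
  assumes w: "w \<in> pos_inv" and h: "norm (w - 1) \<le> 1 / 2"
  shows "\<bar>thompson_dist 1 w - norm (w - 1)\<bar> \<le> 2 * (norm (w - 1))\<^sup>2"
proof -
  let ?h = "norm (w - 1)" and ?e = "thompson_dist 1 w"
  have "1 + ?h \<le> exp ?e" using norm_minus_one_le[OF w] by simp
  then have "ln (1 + ?h) \<le> ?e" by (smt (verit) ln_exp ln_mono norm_ge_zero)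
  moreover have "?h - ?h\<^sup>2 \<le> ln (1 + ?h)" using h by (intro ln_one_plus_pos_lower_bound) auto
  moreover have "?e \<le> - ln (1 - ?h)"
    unfolding thompson_dist_one_le_iff[OF w]
  proof
    have ex: "exp (- ln (1 - ?h)) = 1 / (1 - ?h)" using h by (simp add: exp_minus inverse_eq_divide)
    have "norm (inv_el (1 - (1 - w))) \<le> 1 / (1 - norm (1 - w))"
      using h by (intro neumann) (simp add: norm_minus_commute)
    then show "norm (inv_el w) \<le> exp (- ln (1 - ?h))" using ex by (simp add: norm_minus_commute)
    have "norm w \<le> 1 + ?h" using norm_triangle_ineq[of 1 "w - 1"] by simp
    also have "(1 + ?h) * (1 - ?h) \<le> 1" by (simp add: algebra_simps)
    then have "1 + ?h \<le> 1 / (1 - ?h)" using h by (simp add: field_simps)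
    finally show "norm w \<le> exp (- ln (1 - ?h))" using ex by simp
  qed
  moreover have "- ?h - 2 * ?h\<^sup>2 \<le> ln (1 - ?h)" using h by (intro ln_one_minus_pos_lower_bound) auto
  ultimately show ?thesis using zero_le_power2[of ?h] unfolding abs_le_iff by linarith
qed

lemma scaled_tendsto_imp_tendsto:
  fixes w :: "nat \<Rightarrow> 'a::real_normed_algebra_1"
  assumes "(\<lambda>n. scaleR (2 ^ n) (w n - 1)) \<longlonglongrightarrow> N" shows "w \<longlonglongrightarrow> 1"
proof -
  have "(\<lambda>n. scaleR ((1 / 2) ^ n) (scaleR (2 ^ n) (w n - 1))) \<longlonglongrightarrow> scaleR 0 N"
    by (intro tendsto_scaleR assms LIMSEQ_power_zero) auto
  then have "(\<lambda>n. w n - 1) \<longlonglongrightarrow> 0" by (simp add: power_mult_distrib[symmetric])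
  then show ?thesis by (simp add: LIM_zero_iff)
qed

text \<open>After scaling by \<open>2 ^ n\<close>, the quadratic error is a convergent sequence
  times a null sequence.\<close>

lemma thompson_dist_one_limit:
  assumes w: "\<And>n. w n \<in> pos_inv" and lim: "(\<lambda>n. scaleR (2 ^ n) (w n - 1)) \<longlonglongrightarrow> N"
  shows "(\<lambda>n. 2 ^ n * thompson_dist 1 (w n)) \<longlonglongrightarrow> norm N"
proof -
  have w1: "w \<longlonglongrightarrow> 1" using lim by (rule scaled_tendsto_imp_tendsto)
  then have h0: "(\<lambda>n. norm (w n - 1)) \<longlonglongrightarrow> 0" using LIM_zero tendsto_norm_zero by blast
  have l: "(\<lambda>n. 2 ^ n * norm (w n - 1)) \<longlonglongrightarrow> norm N" using tendsto_norm[OF lim] by simp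
  have "\<forall>\<^sub>F n in sequentially. norm (w n - 1) < 1 / 2" using h0 by (rule order_tendstoD) simp
  then have ev: "\<forall>\<^sub>F n in sequentially. norm (2 ^ n * thompson_dist 1 (w n) - 2 ^ n * norm (w n - 1))
      \<le> 2 * (2 ^ n * norm (w n - 1)) * norm (w n - 1)"
  proof eventually_elim
    case (elim n)
    have "2 ^ n * thompson_dist 1 (w n) - 2 ^ n * norm (w n - 1) =
        2 ^ n * (thompson_dist 1 (w n) - norm (w n - 1))"
      by (rule right_diff_distrib[symmetric])
    then have "norm (2 ^ n * thompson_dist 1 (w n) - 2 ^ n * norm (w n - 1)) =
        2 ^ n * \<bar>thompson_dist 1 (w n) - norm (w n - 1)\<bar>"
      by (simp add: abs_mult)
    also have "\<dots> \<le> 2 ^ n * (2 * (norm (w n - 1))\<^sup>2)"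
      using thompson_dist_one_near[OF w, of n] elim by (intro mult_left_mono) auto
    finally show ?case by (simp add: power2_eq_square mult_ac)
  qed
  have "(\<lambda>n. 2 * (2 ^ n * norm (w n - 1)) * norm (w n - 1)) \<longlonglongrightarrow> 2 * norm N * 0"
    by (intro tendsto_intros l h0)
  then have "(\<lambda>n. 2 * (2 ^ n * norm (w n - 1)) * norm (w n - 1)) \<longlonglongrightarrow> 0" by (simp only: mult_zero_right)
  with ev have "(\<lambda>n. 2 ^ n * thompson_dist 1 (w n) - 2 ^ n * norm (w n - 1)) \<longlonglongrightarrow> 0"
    by (rule Lim_null_comparison)
  from tendsto_add[OF this l] show ?thesis by simp
qed

text \<open>To first order in \<open>y - 1\<close>, the products \<open>x y^2 x\<close> and \<open>y x^2 y\<close> differ by the double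
  commutator \<open>[x,[x,y]] = x^2 y - 2 x y x + y x^2\<close>.\<close>

lemma thompson_dist_double_commutator:
  assumes x: "x \<in> pos_inv" and y: "\<And>n. y n \<in> pos_inv"
    and lim: "(\<lambda>n. scaleR (2 ^ n) (y n - 1)) \<longlonglongrightarrow> Y"
  shows "(\<lambda>n. 2 ^ n * thompson_dist (x * (y n * y n) * x) (y n * (x * x) * y n))
    \<longlonglongrightarrow> norm (inv_el x * commutator x (commutator x Y) * inv_el x)"
proof -
  define i where "i = inv_el x"
  define j where "j n = inv_el (y n)" for n
  \<comment> \<open>The congruence that sends \<open>x * (y n * y n) * x\<close> to 1 sends the
    other product to \<open>w n\<close>, so the distance in question is measured from 1.\<close>
  define w where "w n = j n * (i * (y n * (x * x) * y n) * i) * j n" for n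
  have i: "i \<in> pos_inv" and j: "j n \<in> pos_inv" for n
    using x y by (auto simp: i_def j_def pos_inv_inv_el)
  have inv: "invertible_el x" "invertible_el (y n)" for n using x y pos_invD by blast+
  have xx: "x * x \<in> pos_inv" and yy: "y n * y n \<in> pos_inv" for n
    using x y by (auto simp: pos_inv_square pos_invD)
  have y1: "y \<longlonglongrightarrow> 1" using lim by (rule scaled_tendsto_imp_tendsto)
  have j1: "j \<longlonglongrightarrow> 1" using tendsto_inv_el[OF _ y1] by (simp add: j_def[abs_def])
  have w: "w n \<in> pos_inv" for n
    unfolding w_def using i j y xx by (intro pos_inv_congruence) auto
  have d: "thompson_dist (x * (y n * y n) * x) (y n * (x * x) * y n) = thompson_dist 1 (w n)" for n
  proof -
    have "thompson_dist (x * (y n * y n) * x) (y n * (x * x) * y n) =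
        thompson_dist (j n * (i * (x * (y n * y n) * x) * i) * j n) (w n)"
      unfolding w_def using i j x y xx yy by (simp add: thompson_dist_congruence pos_inv_congruence)
    also have "j n * (i * (x * (y n * y n) * x) * i) * j n = 1"
      using inv by (simp add: i_def j_def mult.assoc inv_el_simps)
    finally show ?thesis .
  qed
  define h where "h n = scaleR (2 ^ n) (y n - 1)" for n
  have y_eq: "y n = 1 + scaleR ((1 / 2) ^ n) (h n)" for n
    by (simp add: h_def power_mult_distrib[symmetric])
  \<comment> \<open>An exact expansion; the last two terms are of second order in
    \<open>y n - 1\<close> before scaling and vanish in the limit.\<close>
  have e: "scaleR (2 ^ n) (y n * (x * x) * y n - x * (y n * y n) * x) =
     h n * (x * x) + (x * x) * h n - (x * h n * x + x * h n * x) + h n * (x * x) * (y n - 1) - x * (h n * (y n - 1)) * x" for n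
    by (simp add: h_def algebra_simps scaleR_2)
  have "(\<lambda>n. h n * (x * x) + (x * x) * h n - (x * h n * x + x * h n * x) + h n * (x * x) * (y n - 1) - x * (h n * (y n - 1)) * x)
    \<longlonglongrightarrow> Y * (x * x) + (x * x) * Y - (x * Y * x + x * Y * x) + Y * (x * x) * (1 - 1) - x * (Y * (1 - 1)) * x"
    using lim unfolding h_def[symmetric] by (intro tendsto_intros y1)
  also have "Y * (x * x) + (x * x) * Y - (x * Y * x + x * Y * x) + Y * (x * x) * (1 - 1) - x * (Y * (1 - 1)) * x =
      commutator x (commutator x Y)"
    by (simp add: commutator_def algebra_simps)
  finally have c: "(\<lambda>n. scaleR (2 ^ n) (y n * (x * x) * y n - x * (y n * y n) * x)) \<longlonglongrightarrow> commutator x (commutator x Y)"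
    unfolding e .
  have "scaleR (2 ^ n) (w n - 1) = j n * (i * (scaleR (2 ^ n) (y n * (x * x) * y n - x * (y n * y n) * x)) * i) * j n" for n
  proof -
    have "j n * (i * (x * (y n * y n) * x) * i) * j n = 1"
      using inv by (simp add: i_def j_def mult.assoc inv_el_simps)
    then show ?thesis by (simp add: w_def right_diff_distrib left_diff_distrib scaleR_diff_right)
  qed
  moreover have "(\<lambda>n. j n * (i * (scaleR (2 ^ n) (y n * (x * x) * y n - x * (y n * y n) * x)) * i) * j n)
      \<longlonglongrightarrow> 1 * (i * commutator x (commutator x Y) * i) * 1"
    by (intro tendsto_intros c j1)
  ultimately have "(\<lambda>n. scaleR (2 ^ n) (w n - 1)) \<longlonglongrightarrow> i * commutator x (commutator x Y) * i" by simp
  from thompson_dist_one_limit[OF w this] show ?thesis by (simp add: d i_def)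
qed

text \<open>Commutators ignore the summand 1, so replacing \<open>x n\<close> by
  \<open>2 ^ n (x n - 1)\<close> costs exactly the factor \<open>4 ^ n\<close>; the outer inverses
  tend to 1.\<close>

lemma double_commutator_limit:
  assumes x: "\<And>n. x n \<in> pos_inv" and lim: "(\<lambda>n. scaleR (2 ^ n) (x n - 1)) \<longlonglongrightarrow> X"
  shows "(\<lambda>n. 4 ^ n * norm (inv_el (x n) * commutator (x n) (commutator (x n) Y) * inv_el (x n)))
    \<longlonglongrightarrow> norm (commutator X (commutator X Y))"
proof -
  define h where "h n = scaleR (2 ^ n) (x n - 1)" for n
  have i1: "(\<lambda>n. inv_el (x n)) \<longlonglongrightarrow> 1"
    using tendsto_inv_el[OF _ scaled_tendsto_imp_tendsto[OF lim]] by simp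
  have "commutator (h n) (commutator (h n) Y) = scaleR (4 ^ n) (commutator (x n) (commutator (x n) Y))" for n
  proof -
    have "(4::real) ^ n = 2 ^ n * 2 ^ n" by (simp flip: power_mult_distrib)
    then show ?thesis by (simp add: h_def commutator_def algebra_simps)
  qed
  then have "4 ^ n * norm (inv_el (x n) * commutator (x n) (commutator (x n) Y) * inv_el (x n)) =
      norm (inv_el (x n) * commutator (h n) (commutator (h n) Y) * inv_el (x n))" for n
    by simp
  moreover have "(\<lambda>n. norm (inv_el (x n) * commutator (h n) (commutator (h n) Y) * inv_el (x n)))
     \<longlonglongrightarrow> norm (1 * commutator X (commutator X Y) * 1)"
    unfolding commutator_def using lim unfolding h_def[symmetric] by (intro tendsto_intros i1)
  ultimately show ?thesis by simp
qed

section \<open>Logarithms and exponentials through iterated square roots\<close>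

lemma thompson_dist_root_limit:
  assumes y: "\<And>n. y n \<in> pos_inv" "\<And>n. y (Suc n) * y (Suc n) = y n"
    and lim: "(\<lambda>n. scaleR (2 ^ n) (y n - 1)) \<longlonglongrightarrow> Y"
  shows "norm Y = thompson_dist 1 (y 0)"
proof -
  \<comment> \<open>Squaring doubles the distance from 1, so the scaled distances are
    constant.\<close>
  have "2 ^ n * thompson_dist 1 (y n) = thompson_dist 1 (y 0)" for n
  proof (induction n)
    case (Suc n)
    then show ?case using thompson_dist_one_square[OF y(1)[of "Suc n"]] y(2)[of n] by simp
  qed simp
  then show ?thesis using thompson_dist_one_limit[OF y(1) lim] by (simp add: LIMSEQ_const_iff)
qed

text \<open>The limit is the logarithm of \<open>y 0\<close>. The scaled differences are bounded and
  successive ones differ by \<open>O(2^-n)\<close>, so their telescoping series converges.\<close>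

lemma root_sequence_convergent:
  assumes y: "\<And>n. y n \<in> pos_inv" "\<And>n. y (Suc n) * y (Suc n) = y n"
  obtains Y where "(\<lambda>n. scaleR (2 ^ n) (y n - 1)) \<longlonglongrightarrow> Y"
proof -
  define k where "k n = scaleR (2 ^ n) (y n - 1)" for n
  define e where "e = thompson_dist 1 (y 0)"
  have e0: "e \<ge> 0" using thompson_dist_nonneg[OF pos_inv_one y(1)] by (simp add: e_def)
  have e: "2 ^ n * thompson_dist 1 (y n) = e" for n
  proof (induction n)
    case (Suc n)
    then show ?case using thompson_dist_one_square[OF y(1)[of "Suc n"]] y(2)[of n] by simp
  qed (simp add: e_def)
  define C where "C = e * exp e"
  have C: "norm (k n) \<le> C" for n
  proof -
    let ?u = "thompson_dist 1 (y n)"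
    have u0: "?u \<ge> 0" using thompson_dist_nonneg[OF pos_inv_one y(1)] .
    have "?u \<le> 2 ^ n * ?u" using u0 by (simp add: mult_le_cancel_right1)
    then have ue: "?u \<le> e" using e by simp
    \<comment> \<open>The resulting \<open>exp u - 1 <= u * exp u\<close> makes the bound linear in
      \<open>u\<close>, and \<open>2 ^ n * u\<close> is the constant \<open>e\<close>.\<close>
    have "exp ?u * (1 - exp (- ?u)) \<le> exp ?u * ?u"
      using exp_ge_add_one_self[of "- ?u"] by (intro mult_left_mono) auto
    then have "exp ?u - 1 \<le> exp ?u * ?u" by (simp add: right_diff_distrib flip: exp_add)
    then have "norm (k n) \<le> 2 ^ n * (exp ?u * ?u)"
      using norm_minus_one_le[OF y(1)[of n]] by (simp add: k_def)
    also have "\<dots> = e * exp ?u" using e[of n] by (simp add: mult_ac)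
    also have "\<dots> \<le> C" unfolding C_def using ue e0 by (intro mult_left_mono) auto
    finally show ?thesis .
  qed
  \<comment> \<open>With \<open>u = y (Suc n) - 1\<close> this is
    \<open>y n - 1 = 2 u + u^2\<close>; the factor \<open>(1 / 2) ^ (n + 2)\<close> brings the
    square of \<open>2 ^ Suc n\<close> down to \<open>2 ^ n\<close>.\<close>
  have step: "k n = k (Suc n) + scaleR ((1 / 2) ^ (n + 2)) (k (Suc n) * k (Suc n))" for n
  proof -
    define u where "u = y (Suc n) - 1"
    have "y n - 1 = (u + u) + u * u" unfolding y(2)[of n, symmetric] by (simp add: u_def algebra_simps)
    moreover have "k (Suc n) = scaleR (2 ^ n) (u + u)"
      by (simp add: k_def u_def scaleR_2[symmetric])
    moreover have "scaleR ((1 / 2) ^ (n + 2)) (k (Suc n) * k (Suc n)) = scaleR (2 ^ n) (u * u)"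
      by (simp add: k_def u_def power_divide)
    ultimately show ?thesis by (simp add: k_def scaleR_add_right)
  qed
  have le: "norm (k (Suc n) - k n) \<le> C\<^sup>2 * (1 / 2) ^ n" for n
  proof -
    have "k (Suc n) - k n = - scaleR ((1 / 2) ^ (n + 2)) (k (Suc n) * k (Suc n))"
      by (subst (2) step) simp
    then have "norm (k (Suc n) - k n) = (1 / 2) ^ (n + 2) * norm (k (Suc n) * k (Suc n))"
      by (simp add: power_divide)
    also have "\<dots> \<le> (1 / 2) ^ n * (C * C)"
      using C[of "Suc n"] order.trans[OF norm_ge_zero C]
      by (intro mult_mono order.trans[OF norm_mult_ineq] power_decreasing) (auto intro: order.trans)
    finally show ?thesis by (simp add: power2_eq_square mult_ac)
  qed
  have "summable (\<lambda>n. k (Suc n) - k n)"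
    by (rule summable_comparison_test'[where N=0 and g="\<lambda>n. C\<^sup>2 * (1 / 2) ^ n"])
      (auto intro!: summable_mult summable_geometric le)
  then have "convergent (\<lambda>n. k 0 + (\<Sum>i<n. k (Suc i) - k i))"
    by (intro convergent_add convergent_const) (simp add: summable_iff_convergent)
  then obtain Y where Y: "k \<longlonglongrightarrow> Y" by (auto simp: sum_lessThan_telescope convergent_def)
  then show thesis unfolding k_def[abs_def] by (rule that)
qed

text \<open>\<open>exp X\<close> is the square of \<open>exp (X / 2)\<close>, which is self-adjoint
  termwise and inverted by \<open>exp (- X / 2)\<close>.\<close>

lemma exp_pos_inv:
  assumes X: "self_adjoint X" shows "exp X \<in> pos_inv"
proof -
  let ?h = "exp (scaleR (1 / 2) X)"
  have sX: "self_adjoint (scaleR (1 / 2) X)" using X by (simp add: self_adjoint_simps)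
  have "(\<lambda>n. cstar (scaleR (inverse (fact n)) (scaleR (1 / 2) X ^ n))) sums cstar ?h"
    by (rule bounded_linear.sums[OF bounded_linear_cstar exp_converges])
  also have "(\<lambda>n. cstar (scaleR (inverse (fact n)) (scaleR (1 / 2) X ^ n))) =
      (\<lambda>n. scaleR (inverse (fact n)) (scaleR (1 / 2) X ^ n))"
    using sX by (simp add: cstar_scaleR cstar_power self_adjoint_def)
  finally have "cstar ?h = ?h" by (rule sums_unique2[OF _ exp_converges])
  then have h: "self_adjoint ?h" by (simp add: self_adjoint_def)
  have "exp X = ?h * ?h" by (subst exp_add_commuting[symmetric]) (simp_all flip: scaleR_left_distrib)
  moreover have "invertible_el ?h"
    using exp_minus_inverse[of "scaleR (1 / 2) X"] exp_minus_inverse[of "- scaleR (1 / 2) X"]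
    by (intro invertible_elI) auto
  ultimately show ?thesis using h by (simp add: pos_inv_square)
qed

text \<open>The limit is the derivative of \<open>exp (t X)\<close> at 0, sampled at
  \<open>t = (1 / 2) ^ n\<close>.\<close>

lemma exp_root_sequence:
  fixes X :: "'a::cstar_algebra"
  assumes X: "self_adjoint X"
  obtains x where "\<And>n. x n \<in> pos_inv" "\<And>n. x (Suc n) * x (Suc n) = x n"
    "(\<lambda>n. scaleR (2 ^ n) (x n - 1)) \<longlonglongrightarrow> X"
proof -
  define f where "f t = exp (scaleR t X)" for t
  show thesis
  proof (rule that[of "\<lambda>n. f ((1 / 2) ^ n)"])
    show "f ((1 / 2) ^ n) \<in> pos_inv" for n
      unfolding f_def using X by (intro exp_pos_inv) (simp add: self_adjoint_simps)
    show "f ((1 / 2) ^ Suc n) * f ((1 / 2) ^ Suc n) = f ((1 / 2) ^ n)" for n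
      unfolding f_def by (subst exp_add_commuting[symmetric]) (simp_all flip: scaleR_left_distrib)
    have "(f has_vector_derivative X) (at 0)"
      using exp_scaleR_has_vector_derivative_right[of X 0] by (simp add: f_def[abs_def])
    then have "((\<lambda>h. norm (f (0 + h) - f 0 - scaleR h X) / norm h) \<longlongrightarrow> 0) (at 0)"
      by (simp add: has_vector_derivative_def has_derivative_at)
    moreover have "filterlim (\<lambda>n. (1 / 2 :: real) ^ n) (at 0) sequentially"
      by (auto simp: filterlim_at intro!: LIMSEQ_power_zero)
    ultimately have "(\<lambda>n. norm (f (0 + (1 / 2) ^ n) - f 0 - scaleR ((1 / 2) ^ n) X) / norm ((1 / 2 :: real) ^ n)) \<longlonglongrightarrow> 0"
      by (rule filterlim_compose)
    moreover have "norm (f (0 + (1 / 2) ^ n) - f 0 - scaleR ((1 / 2) ^ n) X) / norm ((1 / 2 :: real) ^ n) =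
        norm (scaleR (2 ^ n) (f ((1 / 2) ^ n) - 1) - X)" for n
    proof -
      have "scaleR (2 ^ n) (f ((1 / 2) ^ n) - 1) - X = scaleR (2 ^ n) (f (0 + (1 / 2) ^ n) - f 0 - scaleR ((1 / 2) ^ n) X)"
        by (simp add: f_def algebra_simps power_divide)
      then have "norm (scaleR (2 ^ n) (f ((1 / 2) ^ n) - 1) - X) =
          2 ^ n * norm (f (0 + (1 / 2) ^ n) - f 0 - scaleR ((1 / 2) ^ n) X)"
        by simp
      then show ?thesis by (simp add: power_divide)
    qed
    ultimately have "(\<lambda>n. scaleR (2 ^ n) (f ((1 / 2) ^ n) - 1) - X) \<longlonglongrightarrow> 0"
      by (simp add: tendsto_norm_zero_iff)
    then show "(\<lambda>n. scaleR (2 ^ n) (f ((1 / 2) ^ n) - 1)) \<longlonglongrightarrow> X" by (simp add: LIM_zero_iff)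
  qed
qed

section \<open>Extremal double commutators\<close>

lemma power_add_orthogonal:
  fixes a b :: "'a::ring_1"
  assumes "a * b = 0" "b * a = 0"
  shows "(a + b) ^ (2 ^ k) = a ^ (2 ^ k) + b ^ (2 ^ k)"
proof (induction k)
  case (Suc k)
  have z: "a ^ Suc m * b ^ Suc n = 0" "b ^ Suc m * a ^ Suc n = 0" for m n
  proof -
    have "a ^ Suc m * b ^ Suc n = a ^ m * (a * b) * b ^ n" "b ^ Suc m * a ^ Suc n = b ^ m * (b * a) * a ^ n"
      by (simp_all only: power_Suc2[of _ m] power_Suc[of _ n] mult.assoc)
    then show "a ^ Suc m * b ^ Suc n = 0" "b ^ Suc m * a ^ Suc n = 0" by (simp_all only: assms) simp_all
  qed
  \<comment> \<open>The exponent must be positive for the mixed products to contain a factor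
    \<open>a * b\<close> or \<open>b * a\<close>.\<close>
  obtain m where m: "(2::nat) ^ k = Suc m" by (metis gr0_implies_Suc zero_less_numeral zero_less_power)
  have "(a + b) ^ (2 ^ Suc k) = (a ^ (2 ^ k) + b ^ (2 ^ k)) * (a ^ (2 ^ k) + b ^ (2 ^ k))"
    using Suc by (simp add: mult_2 power_add)
  also have "\<dots> = a ^ (2 ^ k) * a ^ (2 ^ k) + b ^ (2 ^ k) * b ^ (2 ^ k)"
    unfolding m by (simp only: distrib_left distrib_right z) simp
  finally show ?case by (simp add: mult_2 power_add)
qed simp

text \<open>Orthogonality gives \<open>norm (a + b) ^ (2 ^ k) <= 2 * M ^ (2 ^ k)\<close> for all
  \<open>k\<close>, while powers of a ratio above 1 would be unbounded.\<close>

lemma norm_add_orthogonal_le: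
  fixes a b :: "'a::cstar_algebra"
  assumes sa: "self_adjoint a" "self_adjoint b" and ab: "a * b = 0" "b * a = 0"
    and M: "norm a \<le> M" "norm b \<le> M"
  shows "norm (a + b) \<le> M"
proof (rule ccontr)
  assume "\<not> norm (a + b) \<le> M"
  then have gt: "norm (a + b) > M" by simp
  have M0: "M \<ge> 0" using M(1) norm_ge_zero order.trans by blast
  show False
  proof (cases "M = 0")
    case True
    then show False using M gt by simp
  next
    case False
    then have M0: "M > 0" using M0 by simp
    let ?q = "norm (a + b) / M"
    have q: "?q > 1" using gt M0 by simp
    have "?q ^ (2 ^ k) \<le> 2" for k
    proof -
      have "norm (a + b) ^ (2 ^ k) = norm (a ^ (2 ^ k) + b ^ (2 ^ k))"
        using norm_self_adjoint_power[of "a + b" k] sa by (simp add: power_add_orthogonal[OF ab] self_adjoint_simps)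
      also have "\<dots> \<le> norm a ^ (2 ^ k) + norm b ^ (2 ^ k)"
        by (intro norm_triangle_mono norm_power_ineq)
      also have "\<dots> \<le> 2 * M ^ (2 ^ k)"
        using power_mono[OF M(1), of "2 ^ k"] power_mono[OF M(2), of "2 ^ k"] by simp
      finally show ?thesis using M0 by (simp add: power_divide field_simps)
    qed
    moreover obtain n where "?q ^ n > 2" using real_arch_pow[OF q] by blast
    moreover have "?q ^ n \<le> ?q ^ (2 ^ n)" using q by (intro power_increasing) (auto intro: less_imp_le)
    ultimately show False by (meson not_le order.trans)
  qed
qed

text \<open>The parts are \<open>(s + X) / 2\<close> and \<open>(s - X) / 2\<close>, where
  \<open>s\<close> is the absolute value of \<open>X\<close>. Both lie between 0 and
  \<open>r\<close>, which is recorded as a norm bound about the midpoint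
  \<open>r / 2\<close>.\<close>

lemma positive_negative_parts:
  fixes X :: "'a::cstar_algebra"
  assumes X: "self_adjoint X" and r: "norm X \<le> r"
  obtains p q where "self_adjoint p" "self_adjoint q" "X = p - q" "p * q = 0" "q * p = 0"
    "norm (p - of_real (r / 2)) \<le> r / 2" "norm (q - of_real (r / 2)) \<le> r / 2"
proof -
  obtain s where s: "positive_el s" "s * s = X * X" "\<And>z. X * X * z = z * (X * X) \<Longrightarrow> s * z = z * s"
    using positive_sqrt[OF positive_square[OF X]] by blast
  have sX: "s * X = X * s" by (rule s(3)) (simp add: mult.assoc)
  have sa: "self_adjoint s" using s(1) by (rule positive_self_adjoint)
  have r0: "r \<ge> 0" using r norm_ge_zero order.trans by blast
  have "norm s * norm s = norm X * norm X"
    using norm_self_adjoint_square[OF sa] norm_self_adjoint_square[OF X] s(2) by simp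
  then have ns: "norm s = norm X" by (metis abs_norm_cancel real_sqrt_abs2)
  define P where "P x = scaleR (1 / 2) (s + x)" for x
  have PP: "P X * P (- X) = 0" "P (- X) * P X = 0"
    using s(2) sX by (simp_all add: P_def algebra_simps)
  have main: "self_adjoint (P x) \<and> norm (P x - of_real (r / 2)) \<le> r / 2" if x: "x = X \<or> x = - X" for x
  proof -
    have saP: "self_adjoint (P x)" using x X sa by (auto simp: P_def intro!: self_adjoint_simps)
    have "norm (s + x) \<le> r + r"
      using x ns r by (intro norm_triangle_mono) auto
    then have nP: "norm (P x) \<le> r" by (simp add: P_def)
    have PP': "P x * P (- x) = 0" "P (- x) * P x = 0" using PP x by auto
    have sum: "P x + P (- x) = s" by (simp add: P_def flip: scaleR_add_right scaleR_2)
    have "positive_el (P x)" unfolding positive_iff_shifts_invertible[OF saP]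
    proof (intro allI impI)
      fix l :: real assume l: "l > 0"
      \<comment> \<open>The cross terms vanish, so \<open>u * v = l (s + l)\<close>, which is
        invertible as \<open>s\<close> is positive; hence so is the factor \<open>u\<close>.\<close>
      let ?u = "P x + of_real l" and ?v = "P (- x) + of_real l"
      have e: "?u * ?v = scaleR l (s + of_real l)" "?v * ?u = scaleR l (s + of_real l)"
        unfolding sum[symmetric] by (simp_all add: distrib_left distrib_right PP' scaleR_add_right of_real_def)
      have "invertible_el (s + of_real l)" using s(1) positive_iff_shifts_invertible[OF sa] l by blast
      then have "invertible_el (?u * ?v)" unfolding e using l by (simp add: invertible_scaleR)
      then show "invertible_el ?u" using e by (intro invertible_commuting_factor[of ?u ?v]) auto
    qed
    moreover from this have "positive_el (of_real r - P x)" using positive_norm_le_iff[OF _ r0] nP by blast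
    moreover have "of_real (r / 2) + (P x - of_real (r / 2)) = P x" by simp
    moreover have "of_real (r / 2) - (P x - of_real (r / 2)) = of_real r - P x"
      by (simp add: algebra_simps flip: of_real_add)
    moreover have "self_adjoint (P x - of_real (r / 2))" "r / 2 \<ge> 0"
      using saP r0 by (simp_all add: self_adjoint_simps)
    ultimately show ?thesis using saP norm_le_iff_positive by metis
  qed
  show thesis
  proof (rule that[of "P X" "P (- X)"])
    show "X = P X - P (- X)" by (simp add: P_def flip: scaleR_diff_right scaleR_2)
  qed (use PP main in auto)
qed

lemma self_adjoint_i_commutator:
  "self_adjoint x \<Longrightarrow> self_adjoint y \<Longrightarrow> self_adjoint (scaleC \<i> (commutator x y))"
  by (simp add: self_adjoint_def commutator_def cstar_scaleC cstar_diff cstar_mult scaleC_minus_left scaleC_diff_right)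

lemma commute_if_self_adjoint_commute:
  fixes x y :: "'a::cstar_algebra"
  assumes "\<And>a b :: 'a. self_adjoint a \<Longrightarrow> self_adjoint b \<Longrightarrow> a * b = b * a"
  shows "x * y = y * x"
proof -
  have dec: "\<exists>a b. self_adjoint a \<and> self_adjoint b \<and> z = a + scaleC \<i> b" for z :: 'a
  proof (intro exI conjI)
    let ?a = "scaleC (1 / 2) (z + cstar z)" and ?b = "scaleC (- \<i> / 2) (z - cstar z)"
    show "self_adjoint ?a" by (simp add: self_adjoint_def cstar_scaleC cstar_add cstar_cstar add.commute)
    show "self_adjoint ?b"
      by (simp add: self_adjoint_def cstar_scaleC cstar_diff cstar_cstar scaleC_diff_right scaleC_minus_left)
    have "?a + scaleC \<i> ?b = scaleC (1 / 2) z + scaleC (1 / 2) z"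
      by (simp add: scaleC_scaleC scaleC_diff_right scaleC_add_right)
    also have "\<dots> = z" by (simp add: scaleC_one flip: scaleC_add_left)
    finally show "z = ?a + scaleC \<i> ?b" by simp
  qed
  obtain a b c d where sa: "self_adjoint a" "self_adjoint b" "self_adjoint c" "self_adjoint d"
    and e: "x = a + scaleC \<i> b" "y = c + scaleC \<i> d"
    using dec[of x] dec[of y] by blast
  show ?thesis
    unfolding e using assms[OF sa(1,3)] assms[OF sa(1,4)] assms[OF sa(2,3)] assms[OF sa(2,4)]
    by (simp add: algebra_simps mult_scaleC_left mult_scaleC_right scaleC_add_right)
qed

text \<open>Let \<open>X = p - q\<close> with orthogonal positive parts. Without nilpotents \<open>p w q = 0\<close> for all \<open>w\<close>,
  whence \<open>[p,Z]\<close> and \<open>[q,Z]\<close> are orthogonal. Shifting \<open>p\<close> and \<open>q\<close> by half the norm of \<open>X\<close> does not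
  change these commutators, so the bound for \<open>[X,Z]\<close> improves by a factor of two.\<close>

lemma commute_if_no_nilpotents:
  fixes x y :: "'a::cstar_algebra"
  assumes red: "\<And>n :: 'a. n * n = 0 \<Longrightarrow> n = 0"
  shows "x * y = y * x"
proof (rule commute_if_self_adjoint_commute)
  fix X Z :: 'a assume X: "self_adjoint X" and Z: "self_adjoint Z"
  \<comment> \<open>\<open>r\<close> stays arbitrary because the induction hypothesis is applied at
    \<open>r / 2\<close>. Letting \<open>k\<close> grow at fixed \<open>X\<close> then forces the
    commutator to vanish.\<close>
  have half: "\<forall>X. self_adjoint X \<longrightarrow> norm X \<le> r \<longrightarrow> norm (commutator X Z) \<le> 2 * r * norm Z / 2 ^ k" for r k
  proof (induction k arbitrary: r)
    case 0
    have "norm (commutator X Z) \<le> 2 * r * norm Z" if "norm X \<le> r" for X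
    proof -
      have "norm (X * Z) \<le> r * norm Z" "norm (Z * X) \<le> r * norm Z"
        using norm_mult_ineq[of X Z] norm_mult_ineq[of Z X] mult_right_mono[OF that, of "norm Z"]
        by (simp_all add: mult.commute)
      then show ?thesis unfolding commutator_def using norm_triangle_ineq4[of "X * Z" "Z * X"] by simp
    qed
    then show ?case by simp
  next
    case (Suc k)
    show ?case
    proof (intro allI impI)
      fix X :: 'a assume X: "self_adjoint X" "norm X \<le> r"
      obtain p q where pq: "self_adjoint p" "self_adjoint q" "X = p - q" "p * q = 0" "q * p = 0"
        "norm (p - of_real (r / 2)) \<le> r / 2" "norm (q - of_real (r / 2)) \<le> r / 2"
        using positive_negative_parts[OF X] .
      \<comment> \<open>These elements square to zero because \<open>q * p\<close> or
        \<open>p * q\<close> occurs inside the square.\<close>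
      have n: "p * (w * q) = 0" "q * (w * p) = 0" for w
      proof -
        have "p * (w * q) * (p * (w * q)) = p * w * (q * p) * w * q"
          "q * (w * p) * (q * (w * p)) = q * w * (p * q) * w * p"
          by (simp_all only: mult.assoc)
        then show "p * (w * q) = 0" "q * (w * p) = 0"
          using red[of "p * (w * q)"] red[of "q * (w * p)"]
          by (simp_all only: pq(4,5) mult_zero_left mult_zero_right simp_thms)
      qed
      have bound: "norm (commutator c Z) \<le> 2 * r * norm Z / 2 ^ Suc k"
        if "self_adjoint c" "norm (c - of_real (r / 2)) \<le> r / 2" for c
      proof -
        have "commutator c Z = commutator (c - of_real (r / 2)) Z"
          by (simp add: commutator_def algebra_simps of_real_def)
        then show ?thesis
          using Suc[of "r / 2", rule_format, of "c - of_real (r / 2)"] that by (simp add: self_adjoint_simps)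
      qed
      \<comment> \<open>Commutators of self-adjoint elements are skew; the factor
        \<open>\<i>\<close> makes them self-adjoint, as the norm bound for orthogonal sums
        demands.\<close>
      let ?a = "scaleC \<i> (commutator p Z)" and ?b = "- scaleC \<i> (commutator q Z)"
      have z: "commutator p Z * commutator q Z = 0" "commutator q Z * commutator p Z = 0"
      proof -
        have "commutator p Z * commutator q Z =
            p * (Z * q) * Z - p * ((Z * Z) * q) - Z * (p * q) * Z + Z * (p * (Z * q))"
          "commutator q Z * commutator p Z =
            q * (Z * p) * Z - q * ((Z * Z) * p) - Z * (q * p) * Z + Z * (q * (Z * p))"
          by (simp_all add: commutator_def algebra_simps)
        then show "commutator p Z * commutator q Z = 0" "commutator q Z * commutator p Z = 0"
          by (simp_all only: n pq(4,5)) simp_all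
      qed
      have "norm (?a + ?b) \<le> 2 * r * norm Z / 2 ^ Suc k"
      proof (rule norm_add_orthogonal_le)
        show "self_adjoint ?a" "self_adjoint ?b"
          using pq(1,2) Z self_adjoint_i_commutator self_adjoint_simps(6) by blast+
        show "?a * ?b = 0" "?b * ?a = 0"
          using z by (simp_all add: mult_scaleC_left mult_scaleC_right)
        show "norm ?a \<le> 2 * r * norm Z / 2 ^ Suc k" "norm ?b \<le> 2 * r * norm Z / 2 ^ Suc k"
          using bound[OF pq(1,6)] bound[OF pq(2,7)] by (simp_all add: norm_scaleC)
      qed
      also have "?a + ?b = scaleC \<i> (commutator X Z)"
        by (simp add: pq(3) commutator_def algebra_simps scaleC_diff_right scaleC_add_right)
      finally show "norm (commutator X Z) \<le> 2 * r * norm Z / 2 ^ Suc k" by (simp add: norm_scaleC)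
    qed
  qed
  have "(\<lambda>k. 2 * norm X * norm Z * (1 / 2) ^ k) \<longlonglongrightarrow> 2 * norm X * norm Z * 0"
    by (intro tendsto_intros LIMSEQ_power_zero) auto
  then have "norm (commutator X Z) \<le> 2 * norm X * norm Z * 0"
    by (rule LIMSEQ_le_const) (use half[of "norm X"] X in \<open>auto simp: power_divide\<close>)
  then show "X * Z = Z * X" by (simp add: commutator_def)
qed

section \<open>The bound for double commutators and its attainment\<close>

lemma norm_double_commutator_le:
  fixes x y :: "'a::real_normed_algebra"
  shows "norm (commutator x (commutator x y)) \<le> 4 * (norm x)\<^sup>2 * norm y"
proof -
  have le: "norm (commutator x z) \<le> 2 * norm x * norm z" for z
    unfolding commutator_def
    using norm_triangle_ineq4[of "x * z" "z * x"] norm_mult_ineq[of x z] norm_mult_ineq[of z x]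
    by (simp add: mult.assoc mult.commute[of "norm z"])
  have "norm (commutator x (commutator x y)) \<le> 2 * norm x * norm (commutator x y)" by (rule le)
  also have "\<dots> \<le> 2 * norm x * (2 * norm x * norm y)" using le[of y] by (intro mult_left_mono) auto
  finally show ?thesis by (simp add: power2_eq_square mult_ac)
qed

text \<open>Each commutator acts as left multiplication by \<open>2 x\<close>, since
  \<open>x * y\<close> again anticommutes with \<open>x\<close>.\<close>

lemma double_commutator_anticommute:
  fixes x y :: "'a::real_algebra"
  assumes "y * x = - (x * y)"
  shows "commutator x (commutator x y) = scaleR 4 (x * x * y)"
proof -
  have "commutator x y = scaleR 2 (x * y)" by (simp add: commutator_def assms scaleR_2)
  moreover have "x * y * x = - (x * x * y)" by (simp add: mult.assoc assms)
  ultimately have "commutator x (commutator x y) = scaleR 2 (x * x * y) + scaleR 2 (x * x * y)"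
    by (simp add: commutator_def mult.assoc)
  then show ?thesis by (simp flip: scaleR_left_distrib)
qed

text \<open>If \<open>n^2 = 0\<close> then \<open>X = n + n*\<close> and \<open>Y = n n* - n* n\<close> anticommute, like two Pauli matrices.\<close>

lemma extremal_double_commutator:
  fixes n :: "'a::cstar_algebra"
  assumes n: "n * n = 0" "n \<noteq> 0"
  obtains X Y :: 'a where "self_adjoint X" "self_adjoint Y" "commutator X (commutator X Y) \<noteq> 0"
    "norm (commutator X (commutator X Y)) \<ge> 4 * (norm X)\<^sup>2 * norm Y"
proof -
  define m where "m = cstar n"
  define P where "P = n * m"
  define Q where "Q = m * n"
  define N where "N = norm n"
  have N: "N > 0" using n by (simp add: N_def)
  have mm: "m * m = 0" using n(1) cstar_mult[of n n] by (simp add: m_def)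
  have nnz: "n * (n * z) = 0" and mmz: "m * (m * z) = 0" for z
    using n(1) mm by (simp_all flip: mult.assoc)
  have PQ: "P * Q = 0" "Q * P = 0" by (simp_all add: P_def Q_def mult.assoc nnz mmz)
  have sa: "self_adjoint P" "self_adjoint Q" by (simp_all add: self_adjoint_def P_def Q_def m_def cstar_mult cstar_cstar)
  have nPQ: "norm P = N * N" "norm Q = N * N"
    using cstar_identity[of m] cstar_identity[of n] by (simp_all add: P_def Q_def m_def N_def cstar_cstar)
  let ?X = "n + m" and ?Y = "P - Q"
  have saX: "self_adjoint ?X" by (simp add: self_adjoint_def m_def cstar_add cstar_cstar add.commute)
  have XX: "?X * ?X = P + Q" using n(1) mm by (simp add: P_def Q_def algebra_simps)
  have anti: "?Y * ?X = - (?X * ?Y)"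
    using n(1) mm by (simp add: P_def Q_def algebra_simps nnz mmz)
  have "commutator ?X (commutator ?X ?Y) = scaleR 4 (?X * ?X * ?Y)"
    using anti by (rule double_commutator_anticommute)
  also have "?X * ?X * ?Y = P * P - Q * Q" unfolding XX by (simp add: algebra_simps PQ)
  finally have c: "commutator ?X (commutator ?X ?Y) = scaleR 4 (P * P - Q * Q)" .
  have PP: "norm (P * P) = (N * N) * (N * N)" using norm_self_adjoint_square[OF sa(1)] nPQ by simp
  \<comment> \<open>Multiplication by \<open>P * P\<close> kills \<open>Q * Q\<close>, so
    \<open>P * P - Q * Q\<close> has norm at least that of \<open>P * P\<close>, namely
    \<open>N ^ 4\<close>.\<close>
  have "(P * P) * (P * P) = (P * P - Q * Q) * (P * P)"
    using PQ by (simp add: left_diff_distrib mult.assoc) (simp flip: mult.assoc)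
  then have "norm (P * P) * norm (P * P) \<le> norm (P * P - Q * Q) * norm (P * P)"
    using norm_self_adjoint_square[OF self_adjoint_simps(8)[OF sa(1)]] norm_mult_ineq[of "P * P - Q * Q" "P * P"]
    by simp
  then have low: "(N * N) * (N * N) \<le> norm (P * P - Q * Q)" using N by (simp add: PP)
  have "(norm ?X)\<^sup>2 = norm (P + Q)"
    using norm_self_adjoint_square[OF saX] XX by (simp add: power2_eq_square)
  also have "\<dots> \<le> N * N" using sa PQ nPQ by (intro norm_add_orthogonal_le) auto
  finally have nX: "(norm ?X)\<^sup>2 \<le> N * N" .
  have "norm (P + - Q) \<le> N * N"
    using sa PQ nPQ by (intro norm_add_orthogonal_le) (auto simp: self_adjoint_simps)
  then have nY: "norm ?Y \<le> N * N" by simp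
  show thesis
  proof (rule that[of ?X ?Y])
    show "self_adjoint ?X" "self_adjoint ?Y" using saX sa by (simp_all add: self_adjoint_simps)
    have "(norm ?X)\<^sup>2 * norm ?Y \<le> (N * N) * (N * N)" using nX nY by (intro mult_mono) auto
    then show "4 * (norm ?X)\<^sup>2 * norm ?Y \<le> norm (commutator ?X (commutator ?X ?Y))"
      unfolding c using low by simp
    have "(N * N) * (N * N) > 0" using N by simp
    then have "P * P - Q * Q \<noteq> 0" using low by auto
    then show "commutator ?X (commutator ?X ?Y) \<noteq> 0" unfolding c by simp
  qed
qed

section \<open>Dilations of the Thompson metric\<close>

text \<open>\<open>H\<close> and \<open>K\<close> are the logarithms of
  \<open>\<phi> (exp X)\<close> and \<open>\<phi> (exp Y)\<close>: as \<open>\<phi>\<close> respects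
  squares, it maps root sequences to root sequences.\<close>

lemma normalized_dilation_double_commutator:
  fixes \<phi> :: "'a::cstar_algebra \<Rightarrow> 'b::cstar_algebra" and X Y :: 'a
  assumes im: "\<phi> ` pos_inv = pos_inv" and g: "\<gamma> > 0"
    and d: "\<And>x y. x \<in> pos_inv \<Longrightarrow> y \<in> pos_inv \<Longrightarrow> thompson_dist (\<phi> x) (\<phi> y) = \<gamma> * thompson_dist x y"
    and one: "\<phi> 1 = 1" and X: "self_adjoint X" and Y: "self_adjoint Y"
  obtains H K :: 'b where "norm H = \<gamma> * norm X" "norm K = \<gamma> * norm Y"
    "norm (commutator H (commutator H K)) = \<gamma> * norm (commutator X (commutator X Y))"
proof -
  have P: "\<phi> x \<in> pos_inv" if "x \<in> pos_inv" for x using im that by blast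
  have refl: "\<phi> (reflect m a) = reflect (\<phi> m) (\<phi> a)" if "a \<in> pos_inv" "m \<in> pos_inv" for a m
    using dilation_reflect[OF im g d that] .
  have inv: "\<phi> (inv_el a) = inv_el (\<phi> a)" if "a \<in> pos_inv" for a
    using refl[OF that pos_inv_one] by (simp add: reflect_def one)
  have triple: "\<phi> (m * a * m) = \<phi> m * \<phi> a * \<phi> m" if "a \<in> pos_inv" "m \<in> pos_inv" for a m
    using refl[OF pos_inv_inv_el[OF that(1)] that(2)] inv[OF that(1)] that P
    by (simp add: reflect_def inv_el_inv_el pos_invD)
  have sq: "\<phi> (m * m) = \<phi> m * \<phi> m" if "m \<in> pos_inv" for m
    using triple[OF pos_inv_one that] by (simp add: one)
  obtain x where x: "\<And>n. x n \<in> pos_inv" "\<And>n. x (Suc n) * x (Suc n) = x n"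
    "(\<lambda>n. scaleR (2 ^ n) (x n - 1)) \<longlonglongrightarrow> X" using exp_root_sequence[OF X] by blast
  obtain y where y: "\<And>n. y n \<in> pos_inv" "\<And>n. y (Suc n) * y (Suc n) = y n"
    "(\<lambda>n. scaleR (2 ^ n) (y n - 1)) \<longlonglongrightarrow> Y" using exp_root_sequence[OF Y] by blast
  have px: "\<phi> (x n) \<in> pos_inv" "\<phi> (x (Suc n)) * \<phi> (x (Suc n)) = \<phi> (x n)"
    and py: "\<phi> (y n) \<in> pos_inv" "\<phi> (y (Suc n)) * \<phi> (y (Suc n)) = \<phi> (y n)" for n
    using x y P sq[symmetric] by auto
  obtain H where H: "(\<lambda>n. scaleR (2 ^ n) (\<phi> (x n) - 1)) \<longlonglongrightarrow> H"
    using root_sequence_convergent[of "\<lambda>n. \<phi> (x n)"] px by blast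
  obtain K where K: "(\<lambda>n. scaleR (2 ^ n) (\<phi> (y n) - 1)) \<longlonglongrightarrow> K"
    using root_sequence_convergent[of "\<lambda>n. \<phi> (y n)"] py by blast
  have d1: "thompson_dist 1 (\<phi> a) = \<gamma> * thompson_dist 1 a" if "a \<in> pos_inv" for a
    using d[OF pos_inv_one that] by (simp add: one)
  show thesis
  proof (rule that)
    show "norm H = \<gamma> * norm X"
      using thompson_dist_root_limit[OF px H] thompson_dist_root_limit[OF x] d1[OF x(1)] by simp
    show "norm K = \<gamma> * norm Y"
      using thompson_dist_root_limit[OF py K] thompson_dist_root_limit[OF y] d1[OF y(1)] by simp
    \<comment> \<open>The limits are taken one after the other: here \<open>a\<close> is fixed and
      only \<open>y n\<close> tends to 1; afterwards \<open>a\<close> runs through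
      \<open>x n\<close>.\<close>
    have eq: "norm (inv_el (\<phi> a) * commutator (\<phi> a) (commutator (\<phi> a) K) * inv_el (\<phi> a)) =
        \<gamma> * norm (inv_el a * commutator a (commutator a Y) * inv_el a)" if a: "a \<in> pos_inv" for a
    proof (rule LIMSEQ_unique)
      show "(\<lambda>n. 2 ^ n * thompson_dist (\<phi> a * (\<phi> (y n) * \<phi> (y n)) * \<phi> a) (\<phi> (y n) * (\<phi> a * \<phi> a) * \<phi> (y n)))
        \<longlonglongrightarrow> norm (inv_el (\<phi> a) * commutator (\<phi> a) (commutator (\<phi> a) K) * inv_el (\<phi> a))"
        using P[OF a] py(1) K by (rule thompson_dist_double_commutator)
      have "2 ^ n * thompson_dist (\<phi> a * (\<phi> (y n) * \<phi> (y n)) * \<phi> a) (\<phi> (y n) * (\<phi> a * \<phi> a) * \<phi> (y n)) =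
          \<gamma> * (2 ^ n * thompson_dist (a * (y n * y n) * a) (y n * (a * a) * y n))" for n
      proof -
        have s: "z * z \<in> pos_inv" if "z \<in> pos_inv" for z :: 'a using that by (simp add: pos_inv_square pos_invD)
        have "thompson_dist (\<phi> (a * (y n * y n) * a)) (\<phi> (y n * (a * a) * y n)) =
            \<gamma> * thompson_dist (a * (y n * y n) * a) (y n * (a * a) * y n)"
          using a y(1) s by (intro d pos_inv_congruence) auto
        then show ?thesis using a y(1) s by (simp add: triple sq)
      qed
      then show "(\<lambda>n. 2 ^ n * thompson_dist (\<phi> a * (\<phi> (y n) * \<phi> (y n)) * \<phi> a) (\<phi> (y n) * (\<phi> a * \<phi> a) * \<phi> (y n)))
        \<longlonglongrightarrow> \<gamma> * norm (inv_el a * commutator a (commutator a Y) * inv_el a)"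
        by (simp only:) (intro tendsto_mult tendsto_const thompson_dist_double_commutator[OF a y(1,3)])
    qed
    have "(\<lambda>n. 4 ^ n * norm (inv_el (\<phi> (x n)) * commutator (\<phi> (x n)) (commutator (\<phi> (x n)) K) * inv_el (\<phi> (x n))))
      \<longlonglongrightarrow> norm (commutator H (commutator H K))"
      using px(1) H by (rule double_commutator_limit)
    moreover have "(\<lambda>n. \<gamma> * (4 ^ n * norm (inv_el (x n) * commutator (x n) (commutator (x n) Y) * inv_el (x n))))
      \<longlonglongrightarrow> \<gamma> * norm (commutator X (commutator X Y))"
      by (intro tendsto_intros double_commutator_limit x)
    ultimately show "norm (commutator H (commutator H K)) = \<gamma> * norm (commutator X (commutator X Y))"
      by (simp add: eq[OF x(1)] mult.left_commute LIMSEQ_unique)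
  qed
qed

text \<open>Congruence by the inverse root of \<open>\<phi> 1\<close> is an isometry of the cone
  onto itself and restores the normalization \<open>\<phi> 1 = 1\<close>.\<close>

lemma dilation_double_commutator:
  fixes \<phi> :: "'a::cstar_algebra \<Rightarrow> 'b::cstar_algebra" and X Y :: 'a
  assumes im: "\<phi> ` pos_inv = pos_inv" and g: "\<gamma> > 0"
    and d: "\<And>x y. x \<in> pos_inv \<Longrightarrow> y \<in> pos_inv \<Longrightarrow> thompson_dist (\<phi> x) (\<phi> y) = \<gamma> * thompson_dist x y"
    and X: "self_adjoint X" and Y: "self_adjoint Y"
  obtains H K :: 'b where "norm H = \<gamma> * norm X" "norm K = \<gamma> * norm Y"
    "norm (commutator H (commutator H K)) = \<gamma> * norm (commutator X (commutator X Y))"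
proof -
  have P: "\<phi> x \<in> pos_inv" if "x \<in> pos_inv" for x using im that by blast
  obtain s where s: "s \<in> pos_inv" "s * s = \<phi> 1" using pos_inv_sqrt[OF P[OF pos_inv_one]] .
  define c where "c = inv_el s"
  have c: "c \<in> pos_inv" using s by (simp add: c_def pos_inv_inv_el)
  define \<psi> where "\<psi> x = c * \<phi> x * c" for x
  have "\<psi> ` pos_inv = pos_inv"
  proof
    show "\<psi> ` pos_inv \<subseteq> pos_inv" using c P by (auto simp: \<psi>_def pos_inv_congruence)
    show "pos_inv \<subseteq> \<psi> ` pos_inv"
    proof
      fix z :: 'b assume z: "z \<in> pos_inv"
      then have "s * z * s \<in> pos_inv" using s by (simp add: pos_inv_congruence)
      then obtain x where x: "x \<in> pos_inv" "\<phi> x = s * z * s" using im by (metis imageE)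
      then have "\<psi> x = z" using pos_invD(2)[OF s(1)] by (simp add: \<psi>_def c_def mult.assoc inv_el_simps)
      with x show "z \<in> \<psi> ` pos_inv" by blast
    qed
  qed
  moreover have "thompson_dist (\<psi> x) (\<psi> y) = \<gamma> * thompson_dist x y" if "x \<in> pos_inv" "y \<in> pos_inv" for x y
    using that c P by (simp add: \<psi>_def thompson_dist_congruence d)
  moreover have "\<psi> 1 = 1" using pos_inv_sqrt_cancel(1)[OF s(1)] by (simp add: \<psi>_def c_def s(2))
  ultimately show thesis using normalized_dilation_double_commutator[of \<psi> \<gamma>] g X Y that by blast
qed

text \<open>The norm of the double commutator scales by \<open>\<gamma>\<close>, but its upper bound
  by \<open>\<gamma> ^ 3\<close>. A pair attaining the bound in the domain therefore forces
  \<open>\<gamma>^2 >= 1\<close>.\<close>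

lemma dilation_noncommutative:
  fixes \<phi> :: "'a::cstar_algebra \<Rightarrow> 'b::cstar_algebra"
  assumes im: "\<phi> ` pos_inv = pos_inv" and g: "\<gamma> > 0"
    and d: "\<And>x y. x \<in> pos_inv \<Longrightarrow> y \<in> pos_inv \<Longrightarrow> thompson_dist (\<phi> x) (\<phi> y) = \<gamma> * thompson_dist x y"
    and nc: "\<not> (\<forall>x y :: 'a. x * y = y * x)"
  shows "\<gamma> \<ge> 1" "\<not> (\<forall>x y :: 'b. x * y = y * x)"
proof -
  obtain n :: 'a where n: "n * n = 0" "n \<noteq> 0" using nc commute_if_no_nilpotents by blast
  obtain X Y :: 'a where XY: "self_adjoint X" "self_adjoint Y" "commutator X (commutator X Y) \<noteq> 0"
    "norm (commutator X (commutator X Y)) \<ge> 4 * (norm X)\<^sup>2 * norm Y"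
    using extremal_double_commutator[OF n] .
  obtain H K :: 'b where HK: "norm H = \<gamma> * norm X" "norm K = \<gamma> * norm Y"
    "norm (commutator H (commutator H K)) = \<gamma> * norm (commutator X (commutator X Y))"
    using dilation_double_commutator[OF im g d XY(1,2)] .
  have "commutator H (commutator H K) \<noteq> 0" using HK(3) XY(3) g by auto
  then show "\<not> (\<forall>x y :: 'b. x * y = y * x)" by (auto simp: commutator_def)
  have "X \<noteq> 0" "Y \<noteq> 0" using XY(3) by (auto simp: commutator_def)
  then have pos: "4 * (norm X)\<^sup>2 * norm Y > 0" by simp
  have "\<gamma> * (4 * (norm X)\<^sup>2 * norm Y) \<le> norm (commutator H (commutator H K))"
    unfolding HK(3) using XY(4) g by simp
  also have "\<dots> \<le> 4 * (norm H)\<^sup>2 * norm K" by (rule norm_double_commutator_le)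
  also have "\<dots> = \<gamma> * (\<gamma>\<^sup>2 * (4 * (norm X)\<^sup>2 * norm Y))"
    by (simp add: HK power_mult_distrib power2_eq_square)
  finally have "1 * (4 * (norm X)\<^sup>2 * norm Y) \<le> \<gamma>\<^sup>2 * (4 * (norm X)\<^sup>2 * norm Y)" using g by simp
  then have "1 \<le> \<gamma>\<^sup>2" using pos by (simp only: mult_le_cancel_right)
  then show "\<gamma> \<ge> 1" using g by (smt (verit) power_less_one_iff pos2)
qed

theorem theorem16:
  fixes \<phi> :: "'a::cstar_algebra \<Rightarrow> 'b::cstar_algebra" and \<gamma> :: real
  assumes "\<phi> ` pos_inv = pos_inv"
    and "\<gamma> > 0" and "\<gamma> \<noteq> 1"
    and "\<forall>A\<in>pos_inv. \<forall>B\<in>pos_inv. thompson_dist (\<phi> A) (\<phi> B) = \<gamma> * thompson_dist A B"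
  shows "(\<forall>x y :: 'a. x * y = y * x) \<and> (\<forall>x y :: 'b. x * y = y * x)"
proof (rule ccontr)
  assume nc: "\<not> ((\<forall>x y :: 'a. x * y = y * x) \<and> (\<forall>x y :: 'b. x * y = y * x))"
  note d = assms(4)[rule_format]
  define V where "V = inv_into pos_inv \<phi>"
  have bij: "bij_betw \<phi> pos_inv pos_inv" using dilation_bij[OF assms(1,2) d] .
  have imV: "V ` pos_inv = pos_inv"
    using bij_betw_inv_into[OF bij] by (simp add: V_def bij_betw_def)
  have dV: "thompson_dist (V x) (V y) = 1 / \<gamma> * thompson_dist x y" if "x \<in> pos_inv" "y \<in> pos_inv" for x y
  proof -
    have "V x \<in> pos_inv" "V y \<in> pos_inv" using imV that by blast+
    moreover have "\<phi> (V x) = x" "\<phi> (V y) = y" using that assms(1) by (simp_all add: V_def f_inv_into_f)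
    ultimately have "thompson_dist x y = \<gamma> * thompson_dist (V x) (V y)" using d[of "V x" "V y"] by simp
    then show ?thesis using assms(2) by simp
  qed
  have g': "1 / \<gamma> > 0" using assms(2) by simp
  \<comment> \<open>Noncommutativity passes through \<open>\<phi>\<close> and through its inverse,
    so both algebras are noncommutative and the bound holds for \<open>\<gamma>\<close> and for
    \<open>1 / \<gamma>\<close>.\<close>
  have ncA: "\<not> (\<forall>x y :: 'a. x * y = y * x)" and ncB: "\<not> (\<forall>x y :: 'b. x * y = y * x)"
    using nc dilation_noncommutative(2)[OF assms(1,2) d] dilation_noncommutative(2)[OF imV g' dV] by blast+
  have "\<gamma> \<ge> 1" using dilation_noncommutative(1)[OF assms(1,2) d ncA] .
  moreover have "1 / \<gamma> \<ge> 1" using dilation_noncommutative(1)[OF imV g' dV ncB] .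
  ultimately show False using assms(3) by (simp add: field_simps)
qed

end
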